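(* Let $\mathbb{K}\in\{\mathbb{R},\mathbb{C}\}$, let $A,E\in\mathbb{K}^{m\times n}$, put $\widetilde{A}=A+E$, and let $k=\operatorname{rank}(A)$. Let $I\subset\{1,\dots,m\}$ and $J\subset\{1,\dots,n\}$, and put $C=A(:,J)$, $R=A(I,:)$, $U=A(I,J)$, $\widetilde{C}=\widetilde{A}(:,J)$, $\widetilde{R}=\widetilde{A}(I,:)$, $\widetilde{U}=\widetilde{A}(I,J)$, $E_I=E(I,:)$, $E_J=E(:,J)$, $E_{I,J}=E(I,J)$. Assume $\operatorname{rank}(C)=\operatorname{rank}(U)=\operatorname{rank}(R)=k$. Let $A=W_k\Sigma_kV_k^*$ be a compact SVD of $A$, and let $W_{k,I}=W_k(I,:)$, $V_{k,J}=V_k(J,:)$. Let $\|\cdot\|$ be a normalized, uniformly generated, unitarily invariant, submultiplicative norm. Then for every $\tau\ge 0$, \begin{align*} \|A-\widetilde{C}[\widetilde{U}]_\tau^\dagger\widetilde{R}\| \leq{}& \|W_{k,I}^\dagger\|\|E_I\|+\|V_{k,J}^\dagger\|\|E_J\|+\|W_{k,I}^\dagger\|\|V_{k,J}^\dagger\|\left(2\|E_{I,J}\|+\|[\widetilde{U}]_{\tau}-U\|\right)\\ &+\|[\widetilde{U}]_\tau^\dagger\|\left[\left(\|W_{k,I}^\dagger\|\|E_I\|+\|V_{k,J}^\dagger\|\|E_J\|+\|W_{k,I}^\dagger\|\|V_{k,J}^\dagger\|\|E_{I,J}\|\right)\|E_{I,J}\|+\|E_I\|\|E_J\|\right]. 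\end{align*}
   Context: For a matrix $B$ and index sets $I,J$, $B(I,J)$ is the submatrix with rows in $I$ and columns in $J$; $B(I,:)$ keeps all columns and $B(:,J)$ keeps all rows. $B^\dagger$ is the Moore--Penrose pseudoinverse. For $\tau\ge0$ and a matrix $B$ with SVD $B=W\Sigma V^*$, $[B]_\tau=W[\Sigma]_\tau V^*$, where $[\Sigma]_\tau(i,i)=\sigma_i(B)$ if $\sigma_i(B)\ge\tau$ and $0$ otherwise; $[B]_\tau^\dagger$ means $([B]_\tau)^\dagger$. The compact SVD of a rank-$k$ matrix $A\in\mathbb{K}^{m\times n}$ is $A=W_k\Sigma_kV_k^*$ with $W_k\in\mathbb{K}^{m\times k}$, $V_k\in\mathbb{K}^{n\times k}$ having orthonormal columns and $\Sigma_k$ the $k\times k$ diagonal matrix of the positive singular values in descending order. A "normalized, uniformly generated, unitarily invariant, submultiplicative norm" is a family of norms $\|\cdot\|:\bigcup_{p,q\ge 1}\mathbb{K}^{p\times q}\to\mathbb{R}$ (a norm on each $\mathbb{K}^{p\times q}$) such that: $\|x\|=\|x\|_2$ (Euclidean norm) for every vector $x$ viewed as a matrix (normalized); there is a single symmetric function $\phi$ with $\|B\|=\phi(\sigma_1(B),\dots,\sigma_r(B))$, $r=\operatorname{rank}(B)$, for matrices $B$ of every size (uniformly generated); $\|\cdot\|$ is invariant under left and right multiplication by unitary matrices; and $\|BD\|\le\|B\|\|D\|$ whenever $BD$ is defined. All Schatten $p$-norms, $1\le p\le\infty$, are examples. *)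

theory Defs
  imports
    Complex_Main
    "Jordan_Normal_Form.Schur_Decomposition"
    "Jordan_Normal_Form.DL_Rank"
    "Jordan_Normal_Form.DL_Submatrix"
begin

text \<open>The scalar field. Up to isomorphism (respecting conjugation and absolute value) the only
  models are the reals and the complex numbers: the last axiom, applied to \<open>x\<close> and \<open>x + 1\<close>, makes
  \<open>x + conjugate x\<close> real, so that \<open>y = (x - conjugate x) / 2\<close> has
  \<open>y\<^sup>2 = - (norm y)\<^sup>2\<close>. The partial order in \<open>conjugatable_ordered_field\<close> is
  used nowhere below; it is kept because the library lemmas on orthogonality assume it.\<close>

class real_or_complex = conjugatable_ordered_field + real_normed_field +
  assumes mult_conjugate_eq: "x * conjugate x = (norm x)\<^sup>2 *\<^sub>R 1"

instance real :: real_or_complex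
  by intro_classes (simp add: power2_eq_square)

instance complex :: real_or_complex
  by intro_classes (simp add: scaleR_conv_of_real flip: complex_norm_square)

definition mat_rank :: "'a::field mat \<Rightarrow> nat" where
  "mat_rank B = vec_space.rank (dim_row B) B"

definition orthonormal_cols :: "'a::conjugatable_field mat \<Rightarrow> bool" where
  "orthonormal_cols W \<longleftrightarrow> mat_adjoint W * W = 1\<^sub>m (dim_col W)"

definition unitary_mat :: "nat \<Rightarrow> 'a::conjugatable_field mat \<Rightarrow> bool" where
  "unitary_mat p W \<longleftrightarrow>
     W \<in> carrier_mat p p \<and> mat_adjoint W * W = 1\<^sub>m p \<and> W * mat_adjoint W = 1\<^sub>m p"

definition moore_penrose :: "'a::conjugatable_field mat \<Rightarrow> 'a mat \<Rightarrow> bool" where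
  "moore_penrose B X \<longleftrightarrow>
     X \<in> carrier_mat (dim_col B) (dim_row B) \<and>
     B * X * B = B \<and> X * B * X = X \<and>
     mat_adjoint (B * X) = B * X \<and> mat_adjoint (X * B) = X * B"

definition pinv :: "'a::conjugatable_field mat \<Rightarrow> 'a mat" where
  "pinv B = (THE X. moore_penrose B X)"

definition rect_diag :: "nat \<Rightarrow> nat \<Rightarrow> real list \<Rightarrow> 'a::real_or_complex mat" where
  "rect_diag p q s = mat p q (\<lambda>(i, j). if i = j then of_real (s ! i) else 0)"

definition is_svd ::
  "'a::real_or_complex mat \<Rightarrow> 'a mat \<Rightarrow> real list \<Rightarrow> 'a mat \<Rightarrow> bool" where
  "is_svd B W s V \<longleftrightarrow>
     unitary_mat (dim_row B) W \<and> unitary_mat (dim_col B) V \<and>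
     length s = min (dim_row B) (dim_col B) \<and>
     sorted_wrt (\<ge>) s \<and> (\<forall>x \<in> set s. x \<ge> 0) \<and>
     B = W * rect_diag (dim_row B) (dim_col B) s * mat_adjoint V"

definition is_compact_svd ::
  "'a::real_or_complex mat \<Rightarrow> 'a mat \<Rightarrow> real list \<Rightarrow> 'a mat \<Rightarrow> bool" where
  "is_compact_svd B W s V \<longleftrightarrow>
     length s = mat_rank B \<and>
     W \<in> carrier_mat (dim_row B) (mat_rank B) \<and> orthonormal_cols W \<and>
     V \<in> carrier_mat (dim_col B) (mat_rank B) \<and> orthonormal_cols V \<and>
     sorted_wrt (\<ge>) s \<and> (\<forall>x \<in> set s. x > 0) \<and>
     B = W * rect_diag (mat_rank B) (mat_rank B) s * mat_adjoint V"

text \<open>The truncation \<open>[B]\<^sub>\<tau>\<close>; the result does not depend on which SVD is chosen.\<close>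

definition sv_truncate :: "real \<Rightarrow> 'a::real_or_complex mat \<Rightarrow> 'a mat" where
  "sv_truncate \<tau> B =
     (SOME T. \<exists>W s V. is_svd B W s V \<and>
        T = W * rect_diag (dim_row B) (dim_col B) (map (\<lambda>x. if x \<ge> \<tau> then x else 0) s)
              * mat_adjoint V)"

text \<open>A norm on matrices of all sizes at once. Sizes 0 are included, so that rank 0 and empty index
  sets make sense; there the axioms force the value 0 and put no constraint on the rest of the
  family. In \<open>uniformly_generated\<close> the entries of \<open>s\<close> are the nonzero singular
  values of \<open>B\<close>, and \<open>\<phi>\<close> is a function of finitely many reals, hence of a list.\<close>

definition norm_family :: "('a::real_or_complex mat \<Rightarrow> real) \<Rightarrow> bool" where
  "norm_family N \<longleftrightarrow> (\<forall>p q.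
     (\<forall>B \<in> carrier_mat p q. N B \<ge> 0 \<and> (N B = 0 \<longleftrightarrow> B = 0\<^sub>m p q)) \<and>
     (\<forall>B \<in> carrier_mat p q. \<forall>c. N (c \<cdot>\<^sub>m B) = norm c * N B) \<and>
     (\<forall>B \<in> carrier_mat p q. \<forall>D \<in> carrier_mat p q. N (B + D) \<le> N B + N D))"

definition normalized :: "('a::real_or_complex mat \<Rightarrow> real) \<Rightarrow> bool" where
  "normalized N \<longleftrightarrow>
     (\<forall>p. \<forall>x \<in> carrier_mat p 1. N x = sqrt (\<Sum>i<p. (norm (x $$ (i, 0)))\<^sup>2))"

definition uniformly_generated :: "('a::real_or_complex mat \<Rightarrow> real) \<Rightarrow> bool" where
  "uniformly_generated N \<longleftrightarrow>
     (\<exists>\<phi> :: real list \<Rightarrow> real.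
        (\<forall>s t. mset s = mset t \<longrightarrow> \<phi> s = \<phi> t) \<and>
        (\<forall>B W s V. is_compact_svd B W s V \<longrightarrow> N B = \<phi> s))"

definition unitarily_invariant :: "('a::real_or_complex mat \<Rightarrow> real) \<Rightarrow> bool" where
  "unitarily_invariant N \<longleftrightarrow>
     (\<forall>p q P Q. \<forall>B \<in> carrier_mat p q.
        unitary_mat p P \<longrightarrow> unitary_mat q Q \<longrightarrow> N (P * B) = N B \<and> N (B * Q) = N B)"

definition submultiplicative :: "('a::real_or_complex mat \<Rightarrow> real) \<Rightarrow> bool" where
  "submultiplicative N \<longleftrightarrow>
     (\<forall>p q r. \<forall>B \<in> carrier_mat p q. \<forall>D \<in> carrier_mat q r. N (B * D) \<le> N B * N D)"

end

theory Submission
  imports Defs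
begin

text \<open>
  Write \<open>T\<close> for the truncation of \<open>Ut\<close>, \<open>X = pinv T\<close>, \<open>L = pinv WkI\<close> and \<open>M = pinv VkJ\<close>. Since
  \<open>U = WkI * \<Sigma> * VkJ\<^sup>*\<close> has rank \<open>k\<close>, the inner factors have full column rank, so
  \<open>L * WkI = 1\<close> and \<open>M * VkJ = 1\<close>. With \<open>F = Wk * L\<close> and \<open>G = (Vk * M)\<^sup>*\<close> this gives
  \<open>C = F * U\<close>, \<open>R = U * G\<close> and \<open>A = F * U * G\<close>: the three matrices differ from the small block \<open>U\<close>
  only by factors whose norm is at most \<open>N L\<close> and \<open>N M\<close>. Expanding \<open>Ct = F * U + EJ\<close> and
  \<open>Rt = U * G + EI\<close>,
  \<open>A - Ct * X * Rt = F * (U - U * X * U) * G - F * (U * X) * EI - EJ * (X * U) * G - EJ * X * EI\<close>.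

  An SVD of \<open>Ut\<close> shows \<open>(Ut - T) * X = 0\<close> and \<open>X * (Ut - T) = 0\<close>, because the discarded and the
  retained singular directions are orthogonal. Hence \<open>U * X = T * X - EIJ * X\<close> and
  \<open>X * U = X * T - X * EIJ\<close>, where \<open>T * X\<close> and \<open>X * T\<close> are orthogonal projections. Multiplication by
  a projection \<open>P\<close> does not increase the norm, since \<open>P\<close> is the mean of the unitary matrices \<open>1\<close> and
  \<open>2 * P - 1\<close>. The four summands are then bounded by the triangle inequality and submultiplicativity
  (\<open>factor_perturbation_bound\<close>).

  Two facts about the norm relate matrices of different sizes: \<open>N (W * B) = N B\<close> when \<open>W\<close> has
  orthonormal columns, and \<open>N (B\<^sup>*) = N B\<close>. Both hold because the two matrices have the same
  singular values, and both need the existence of singular value decompositions over the abstract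
  scalar field. To obtain it, the field is embedded into the complex numbers
  (\<open>embedding_into_complex\<close>), which makes the characteristic polynomial of a Hermitian matrix split
  with real roots (\<open>hermitian_char_poly_splits\<close>). Deflation then yields the spectral theorem
  (\<open>hermitian_spectral\<close>), and the spectral theorem for \<open>B\<^sup>* * B\<close> yields the SVD of \<open>B\<close>
  (\<open>svd_exists\<close>).
\<close>

section \<open>Matrix algebra with conditions on dimensions\<close>

text \<open>Conditions in terms of carrier sets contain indices that do not occur in the equation, which
  rewriting would have to guess. Equations between dimensions can be discharged by simplification.\<close>

lemma mat_assoc_dim:
  fixes A B C :: "'a::semiring_0 mat"
  assumes "dim_col A = dim_row B" "dim_col B = dim_row C"
  shows "A * B * C = A * (B * C)"
  by (rule assoc_mult_mat[OF carrier_matI[OF refl refl] carrier_matI[OF assms(1)[symmetric] refl]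
        carrier_matI[OF assms(2)[symmetric] refl]])

text \<open>In a product associated to the right, a known product \<open>A * B\<close> is not a subterm; this form lets
  identities such as \<open>mat_adjoint W * W = 1\<close> cancel there.\<close>

lemma mat_assoc_cancel:
  fixes A B C :: "'a::semiring_0 mat"
  assumes "A * B = D" "dim_col A = dim_row B" "dim_col B = dim_row C"
  shows "A * (B * C) = D * C"
  using mat_assoc_dim[of A B C] assms by simp

lemma add_mult_dim:
  fixes A B C :: "'a::semiring_0 mat"
  assumes "dim_row A = dim_row B" "dim_col A = dim_col B" "dim_col B = dim_row C"
  shows "(A + B) * C = A * C + B * C"
  by (rule add_mult_distrib_mat[of _ "dim_row B" "dim_col B" _ _ "dim_col C"]) (use assms in auto)

lemma mult_add_dim:
  fixes A B C :: "'a::semiring_0 mat"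
  assumes "dim_col A = dim_row B" "dim_row B = dim_row C" "dim_col B = dim_col C"
  shows "A * (B + C) = A * B + A * C"
  by (rule mult_add_distrib_mat[of _ "dim_row A" "dim_col A" _ "dim_col C"]) (use assms in auto)

lemma minus_mult_dim:
  fixes A B C :: "'a::ring mat"
  assumes "dim_row A = dim_row B" "dim_col A = dim_col B" "dim_col B = dim_row C"
  shows "(A - B) * C = A * C - B * C"
  by (rule minus_mult_distrib_mat[of _ "dim_row B" "dim_col B" _ _ "dim_col C"]) (use assms in auto)

lemma mult_minus_dim:
  fixes A B C :: "'a::ring mat"
  assumes "dim_col A = dim_row B" "dim_row B = dim_row C" "dim_col B = dim_col C"
  shows "A * (B - C) = A * B - A * C"
  by (rule mult_minus_distrib_mat[of _ "dim_row A" "dim_col A" _ "dim_col C"]) (use assms in auto)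

lemma one_mult_dim [simp]:
  fixes A :: "'a::semiring_1 mat"
  shows "dim_row A = n \<Longrightarrow> 1\<^sub>m n * A = A" "dim_col A = n \<Longrightarrow> A * 1\<^sub>m n = A"
  by (rule left_mult_one_mat[of _ _ "dim_col A"] right_mult_one_mat[of _ "dim_row A"]; auto)+

lemma index_mult_sum:
  fixes A B :: "'a::semiring_0 mat"
  assumes "i < dim_row A" "j < dim_col B" "dim_col A = dim_row B"
  shows "(A * B) $$ (i, j) = (\<Sum>k<dim_row B. A $$ (i, k) * B $$ (k, j))"
  using assms by (auto simp: scalar_prod_def atLeast0LessThan intro!: sum.cong)

section \<open>Adjoints and the scalar field\<close>

lemma mat_adjoint_eq:
  "mat_adjoint A = mat (dim_col A) (dim_row A) (\<lambda>(i, j). conjugate (A $$ (j, i)))"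
  by (rule eq_matI) (auto simp: mat_adjoint_def mat_of_rows_def)

lemma dim_adjoint [simp]:
  "dim_row (mat_adjoint A) = dim_col A" "dim_col (mat_adjoint A) = dim_row A"
  by (simp_all add: mat_adjoint_eq)

lemma adjoint_carrier [simp]:
  "mat_adjoint A \<in> carrier_mat p q \<longleftrightarrow> A \<in> carrier_mat q p"
  unfolding carrier_mat_def mem_Collect_eq dim_adjoint by (rule conj_commute)

lemma index_adjoint [simp]:
  "i < dim_col A \<Longrightarrow> j < dim_row A \<Longrightarrow> mat_adjoint A $$ (i, j) = conjugate (A $$ (j, i))"
  by (simp add: mat_adjoint_eq)

lemma adjoint_adjoint [simp]: "mat_adjoint (mat_adjoint A) = A"
  by (rule eq_matI) auto

lemma adjoint_mult:
  assumes "dim_col A = dim_row B"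
  shows "mat_adjoint (A * B) = mat_adjoint B * mat_adjoint (A :: 'a::conjugatable_field mat)"
proof (rule eq_matI)
  fix i j assume ij: "i < dim_row (mat_adjoint B * mat_adjoint A)" "j < dim_col (mat_adjoint B * mat_adjoint A)"
  then have "mat_adjoint (A * B) $$ (i, j) = conjugate ((A * B) $$ (j, i))" by simp
  also have "\<dots> = (\<Sum>k<dim_row B. conjugate (B $$ (k, i)) * conjugate (A $$ (j, k)))"
    using ij assms by (simp add: index_mult_sum sum_conjugate conjugate_dist_mul mult.commute del: index_mult_mat(1))
  also have "\<dots> = (mat_adjoint B * mat_adjoint A) $$ (i, j)"
    using ij assms by (subst index_mult_sum) auto
  finally show "mat_adjoint (A * B) $$ (i, j) = (mat_adjoint B * mat_adjoint A) $$ (i, j)" .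
qed (use assms in auto)

lemma conjugate_diff: "conjugate (a - b) = conjugate a - conjugate (b :: 'a::conjugatable_ring)"
  by (simp only: diff_conv_add_uminus conjugate_dist_add conjugate_neg)

lemma adjoint_minus:
  assumes "dim_row A = dim_row B" "dim_col A = dim_col B"
  shows "mat_adjoint (A - B) = mat_adjoint A - mat_adjoint (B :: 'a::conjugatable_field mat)"
  using assms by (intro eq_matI) (auto simp: conjugate_diff)

lemma adjoint_add:
  assumes "dim_row A = dim_row B" "dim_col A = dim_col B"
  shows "mat_adjoint (A + B) = mat_adjoint A + mat_adjoint (B :: 'a::conjugatable_field mat)"
  using assms by (intro eq_matI) (auto simp: conjugate_dist_add)

lemma conjugate_of_real [simp]: "conjugate (of_real r :: 'a::real_or_complex) = of_real r"
proof (cases "r = 0")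
  case False
  have "of_real r * conjugate (of_real r :: 'a) = of_real r * of_real r"
    unfolding mult_conjugate_eq by (simp add: power2_eq_square scaleR_conv_of_real)
  then show ?thesis using False by simp
qed simp

lemma mult_conjugate_of_real:
  "x * conjugate x = (of_real ((norm x)\<^sup>2) :: 'a::real_or_complex)"
  "conjugate x * x = (of_real ((norm x)\<^sup>2) :: 'a::real_or_complex)"
  using mult_conjugate_eq[of x] by (simp_all add: scaleR_conv_of_real mult.commute)

lemma conjugate_one [simp]: "conjugate (1::'a::real_or_complex) = 1"
  using conjugate_of_real[of 1] by simp

lemma adjoint_one [simp]: "mat_adjoint (1\<^sub>m n :: 'a::real_or_complex mat) = 1\<^sub>m n"
  by (rule eq_matI) auto

text \<open>From \<open>z * z = z * conjugate z = (norm z)\<^sup>2\<close>, a self-conjugate scalar is \<open>\<plusminus> norm z\<close>.\<close>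

lemma self_conjugate_real:
  assumes "conjugate z = (z :: 'a::real_or_complex)"
  obtains r where "z = of_real r"
proof -
  have "z * z = of_real (norm z) * of_real (norm z)"
    using mult_conjugate_of_real(1)[of z] assms by (simp add: power2_eq_square)
  then have "z = of_real (norm z) \<or> z = - of_real (norm z)"
    by (simp only: square_eq_iff)
  then show thesis using that[of "norm z"] that[of "- norm z"] by auto
qed

text \<open>Either every scalar is self-conjugate and hence real, or some difference \<open>x0 - conjugate x0\<close> is
  nonzero. After normalization that difference is an element \<open>i\<close> with \<open>conjugate i = - i\<close> and
  \<open>i * i = - 1\<close>, and the self-conjugate scalars \<open>x + conjugate x\<close> and \<open>(x - conjugate x) * i\<close>
  provide the real and imaginary parts of \<open>x\<close>.\<close>

lemma embedding_into_complex:
  obtains h :: "'a::real_or_complex \<Rightarrow> complex"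
  where "inj_idom_hom h" "\<And>x. h (conjugate x) = cnj (h x)" "\<And>r. h (of_real r) = of_real r"
proof -
  note cm = conjugate_diff
  show thesis
  proof (cases "\<forall>x::'a. conjugate x = x")
    case True
    then have "\<exists>r. x = of_real r" for x :: 'a
      using self_conjugate_real by blast
    then obtain \<rho> where \<rho>: "x = of_real (\<rho> x)" for x :: 'a by metis
    have eqI: "\<rho> y = t" if "y = of_real t" for y :: 'a and t
      using \<rho>[of y] that by simp
    have "\<rho> (x + y) = \<rho> x + \<rho> y" "\<rho> (x * y) = \<rho> x * \<rho> y" for x y
      by (rule eqI, metis \<rho> of_real_add of_real_mult)+
    moreover have "\<rho> (of_real r) = r" for r by (rule eqI) simp
    moreover from this[of 0] this[of 1] have "\<rho> 0 = 0" "\<rho> 1 = 1" by simp_all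
    moreover have "x = 0" if "\<rho> x = 0" for x using \<rho>[of x] unfolding that by simp
    then have "of_real (\<rho> x) = (0::complex) \<Longrightarrow> x = 0" for x by (simp only: of_real_eq_0_iff)
    ultimately show thesis
      using True by (intro that[of "\<lambda>x. of_real (\<rho> x)"], unfold_locales) simp_all
  next
    case False
    then obtain x0 :: 'a where x0: "conjugate x0 \<noteq> x0" by blast
    define i where "i = of_real (inverse (norm (x0 - conjugate x0))) * (x0 - conjugate x0)"
    have ci: "conjugate i = - i"
      unfolding i_def conjugate_dist_mul conjugate_of_real cm conjugate_id by (simp only: minus_mult_right minus_diff_eq)
    have ni: "norm i = 1" using x0 unfolding i_def by (simp add: norm_mult del: of_real_inverse)
    have "- (i * i) = 1"
      using mult_conjugate_of_real(1)[of i] ci ni by simp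
    then have ii: "i * i = - 1"
      by (metis minus_minus)
    have "\<exists>a b. x = of_real a + of_real b * i" for x :: 'a
    proof -
      have "conjugate (x + conjugate x) = x + conjugate x"
        by (simp add: conjugate_dist_add add.commute)
      then obtain a where a: "x + conjugate x = of_real a" by (rule self_conjugate_real)
      \<comment> \<open>Multiplying the skew part by \<open>i\<close> makes it self-conjugate, hence real.\<close>
      have "conjugate ((x - conjugate x) * i) = (conjugate x - x) * (- i)"
        by (simp only: conjugate_dist_mul cm ci conjugate_id)
      also have "\<dots> = (x - conjugate x) * i" by (simp add: algebra_simps)
      finally obtain b where b: "(x - conjugate x) * i = of_real b" by (rule self_conjugate_real)
      have "x - conjugate x = - ((x - conjugate x) * i * i)"
        by (simp only: mult.assoc ii) simp
      then have d: "x - conjugate x = - of_real b * i" using b by simp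
      have "x = of_real (1 / 2) * ((x + conjugate x) + (x - conjugate x))"
        by (simp add: field_simps)
      also have "\<dots> = of_real (a / 2) + of_real (- b / 2) * i"
        unfolding a d by (simp add: field_simps)
      finally show ?thesis by blast
    qed
    then obtain a b where ab: "x = of_real (a x) + of_real (b x) * i" for x by metis
    have i0: "i \<noteq> 0" using ni by auto
    have uniq: "a x = s \<and> b x = t" if x: "x = of_real s + of_real t * i" for x s t
    proof -
      have "of_real (a x) + of_real (b x) * i = of_real s + of_real t * i"
        by (rule trans[OF ab[of x, symmetric] x])
      then have "(of_real (a x) + of_real (b x) * i) - (of_real s + of_real t * i) = 0" by simp
      then have e: "of_real (a x - s) + of_real (b x - t) * i = 0"
        by (simp add: algebra_simps)
      \<comment> \<open>A vanishing combination and its conjugate add up to twice its real part.\<close>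
      then have "conjugate (of_real (a x - s) + of_real (b x - t) * i) = 0"
        by (simp only: conjugate_zero)
      then have "of_real (a x - s) + of_real (b x - t) * (- i) = 0"
        by (simp only: conjugate_dist_add conjugate_dist_mul conjugate_of_real ci)
      then have e': "of_real (a x - s) = of_real (b x - t) * i"
        by (simp only: mult_minus_right add.right_neutral eq_neg_iff_add_eq_0[symmetric] minus_minus)
      from e have "of_real (a x - s) + of_real (a x - s) = (0::'a)"
        by (simp only: e')
      then have "of_real (2 * (a x - s)) = (0::'a)"
        by (simp only: mult_2 of_real_add)
      then have s: "a x - s = 0" by (simp only: of_real_eq_0_iff) simp
      with e' have "of_real (b x - t) * i = 0" by (simp only: of_real_0)
      with i0 have "b x - t = 0" by (simp only: mult_eq_0_iff of_real_eq_0_iff simp_thms)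
      with s show ?thesis by simp
    qed
    define h where "h x = Complex (a x) (b x)" for x
    have hI: "h x = Complex s t" if "x = of_real s + of_real t * i" for x s t
      using uniq[OF that] by (simp only: h_def)
    have "h (x + y) = h x + h y" for x y
    proof -
      have "x + y = (of_real (a x) + of_real (b x) * i) + (of_real (a y) + of_real (b y) * i)"
        by (rule arg_cong2[OF ab ab])
      also have "\<dots> = of_real (a x + a y) + of_real (b x + b y) * i"
        by (simp add: algebra_simps)
      finally have "h (x + y) = Complex (a x + a y) (b x + b y)" by (rule hI)
      then show ?thesis by (simp only:) (simp add: h_def complex_eq_iff)
    qed
    moreover have "h (x * y) = h x * h y" for x y
    proof -
      have "x * y = (of_real (a x) + of_real (b x) * i) * (of_real (a y) + of_real (b y) * i)"
        by (rule arg_cong2[OF ab ab])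
      also have "\<dots> = of_real (a x * a y) + of_real (a x * b y + b x * a y) * i
          + of_real (b x * b y) * (i * i)"
        by (simp add: algebra_simps)
      also have "\<dots> = of_real (a x * a y - b x * b y) + of_real (a x * b y + b x * a y) * i"
        unfolding ii by simp
      finally have "h (x * y) = Complex (a x * a y - b x * b y) (a x * b y + b x * a y)" by (rule hI)
      then show ?thesis by (simp only:) (simp add: h_def complex_eq_iff)
    qed
    moreover have hr: "h (of_real r) = of_real r" for r
      by (subst hI[of _ r 0]) (simp_all add: complex_eq_iff)
    moreover have "h (conjugate x) = cnj (h x)" for x
    proof -
      have "conjugate x = conjugate (of_real (a x) + of_real (b x) * i)"
        by (rule arg_cong[OF ab])
      also have "\<dots> = of_real (a x) + of_real (- b x) * i"
        by (simp add: conjugate_dist_add conjugate_dist_mul ci)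
      finally have "h (conjugate x) = Complex (a x) (- b x)" by (rule hI)
      then show ?thesis by (simp only:) (simp add: h_def complex_eq_iff)
    qed
    moreover from hr[of 0] hr[of 1] have "h 0 = 0" "h 1 = 1" by simp_all
    moreover have "x = 0" if "h x = 0" for x
    proof -
      have "a x = 0" "b x = 0" using that by (simp_all add: h_def complex_eq_iff)
      then show ?thesis by (subst ab[of x]) simp
    qed
    ultimately show thesis by (intro that[of h], unfold_locales)
  qed
qed

section \<open>Real rectangular diagonal matrices\<close>

text \<open>Diagonals are functions here, in contrast to the lists of \<open>rect_diag\<close>: products, differences and
  pseudoinverses of such matrices are then pointwise operations.\<close>

definition real_diag :: "nat \<Rightarrow> nat \<Rightarrow> (nat \<Rightarrow> real) \<Rightarrow> 'a::real_or_complex mat" where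
  "real_diag p q f = mat p q (\<lambda>(i, j). if i = j then of_real (f i) else 0)"

lemma rect_diag_eq_real_diag: "rect_diag p q s = real_diag p q (\<lambda>i. s ! i)"
  by (simp add: rect_diag_def real_diag_def)

lemma dim_real_diag [simp]: "dim_row (real_diag p q f) = p" "dim_col (real_diag p q f) = q"
  by (simp_all add: real_diag_def)

lemma index_real_diag [simp]:
  "i < p \<Longrightarrow> j < q \<Longrightarrow> real_diag p q f $$ (i, j) = (if i = j then of_real (f i) else 0)"
  by (simp add: real_diag_def)

lemma adjoint_real_diag [simp]: "mat_adjoint (real_diag p q f) = real_diag q p f"
  by (rule eq_matI) auto

lemma index_mult_real_diag:
  assumes "i < dim_row A" "j < q" "dim_col A = p"
  shows "(A * real_diag p q f) $$ (i, j) = (if j < p then A $$ (i, j) * of_real (f j) else 0)"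
proof -
  have "(A * real_diag p q f) $$ (i, j) = (\<Sum>k<p. A $$ (i, k) * real_diag p q f $$ (k, j))"
    using assms by (subst index_mult_sum) auto
  also have "\<dots> = (\<Sum>k<p. if k = j then A $$ (i, j) * of_real (f j) else 0)"
    using assms by (intro sum.cong) auto
  finally show ?thesis by simp
qed

lemma real_diag_mult:
  "real_diag p r f * real_diag r q g = real_diag p q (\<lambda>i. if i < r then f i * g i else 0)"
  by (rule eq_matI) (auto simp: index_mult_real_diag simp del: index_mult_mat(1))

lemma real_diag_cong:
  "(\<And>i. i < p \<Longrightarrow> i < q \<Longrightarrow> f i = g i) \<Longrightarrow> real_diag p q f = real_diag p q g"
  by (rule eq_matI) auto

lemma one_mat_real_diag: "1\<^sub>m p = real_diag p p (\<lambda>_. 1)"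
  by (rule eq_matI) auto

lemma zero_mat_real_diag: "0\<^sub>m p q = real_diag p q (\<lambda>_. 0)"
  by (rule eq_matI) auto

lemma real_diag_minus: "real_diag p q f - real_diag p q g = real_diag p q (\<lambda>i. f i - g i)"
  by (rule eq_matI) auto

section \<open>Unitary matrices\<close>

lemma unitary_matD:
  assumes "unitary_mat p W"
  shows "dim_row W = p" "dim_col W = p" "mat_adjoint W * W = 1\<^sub>m p" "W * mat_adjoint W = 1\<^sub>m p"
  using assms by (auto simp: unitary_mat_def)

lemma unitary_matI:
  assumes "dim_row W = p" "dim_col W = p" "mat_adjoint W * W = 1\<^sub>m p"
  shows "unitary_mat p (W :: 'a::conjugatable_field mat)"
proof -
  have c: "W \<in> carrier_mat p p" "mat_adjoint W \<in> carrier_mat p p"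
    using assms(1,2) by (auto intro!: carrier_matI)
  then show ?thesis
    using assms(3) mat_mult_left_right_inverse[OF c(2,1) assms(3)] by (simp add: unitary_mat_def)
qed

lemma unitary_mat_mult:
  fixes W V :: "'a::conjugatable_field mat"
  assumes W: "unitary_mat p W" and V: "unitary_mat p V"
  shows "unitary_mat p (W * V)"
proof (rule unitary_matI)
  note d = unitary_matD(1,2)[OF W] unitary_matD(1,2)[OF V]
  have "mat_adjoint (W * V) * (W * V) = mat_adjoint V * (mat_adjoint W * W * V)"
    by (simp add: adjoint_mult mat_assoc_dim d)
  then show "mat_adjoint (W * V) * (W * V) = 1\<^sub>m p"
    by (simp add: unitary_matD[OF W] unitary_matD[OF V])
qed (simp_all add: unitary_matD[OF W] unitary_matD[OF V])

lemma unitary_conj_cancel: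
  fixes A Q :: "'a::conjugatable_field mat"
  assumes Q: "unitary_mat p Q" and "dim_row A = p" "dim_col A = p"
  shows "Q * (mat_adjoint Q * A * Q) * mat_adjoint Q = A"
proof -
  note d = unitary_matD(1,2)[OF Q]
  have "Q * (mat_adjoint Q * A * Q) * mat_adjoint Q
      = (Q * mat_adjoint Q) * A * (Q * mat_adjoint Q)"
    by (simp add: mat_assoc_dim d assms del: index_mult_mat(1))
  then show ?thesis by (simp add: unitary_matD(4)[OF Q] assms d)
qed

section \<open>The spectral theorem\<close>

text \<open>For an eigenvector \<open>v\<close>, the number \<open>S = v\<^sup>* B v = a * \<parallel>v\<parallel>\<^sup>2\<close> is its own conjugate.\<close>

lemma hermitian_eigenvalue_real:
  fixes B :: "complex mat"
  assumes B: "B \<in> carrier_mat n n" "mat_adjoint B = B" and ev: "eigenvalue B a"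
  shows "a = of_real (Re a)"
proof -
  obtain v where v: "v \<in> carrier_vec n" "v \<noteq> 0\<^sub>v n" and e: "B *\<^sub>v v = a \<cdot>\<^sub>v v"
    using ev B by (auto simp: eigenvalue_def eigenvector_def)
  have sym: "B $$ (i, j) = cnj (B $$ (j, i))" if "i < n" "j < n" for i j
    using index_adjoint[of i B j] that B by simp
  have ve: "(\<Sum>j<n. B $$ (i, j) * v $ j) = a * v $ i" if "i < n" for i
  proof -
    have "(B *\<^sub>v v) $ i = (a \<cdot>\<^sub>v v) $ i" by (simp only: e)
    then show ?thesis using that B v(1) by (simp add: scalar_prod_def atLeast0LessThan)
  qed
  define S where "S = (\<Sum>i<n. \<Sum>j<n. cnj (v $ i) * B $$ (i, j) * v $ j)"
  define r where "r = (\<Sum>i<n. (cmod (v $ i))\<^sup>2)"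
  have "S = (\<Sum>i<n. cnj (v $ i) * (\<Sum>j<n. B $$ (i, j) * v $ j))"
    by (simp add: S_def sum_distrib_left mult.assoc)
  also have "\<dots> = (\<Sum>i<n. a * (v $ i * cnj (v $ i)))"
    by (rule sum.cong) (simp_all add: ve)
  also have "\<dots> = a * of_real r"
    unfolding r_def of_real_sum sum_distrib_left
    by (intro sum.cong) (simp_all only: complex_norm_square)
  finally have S: "S = a * of_real r" .
  have "cnj S = (\<Sum>i<n. \<Sum>j<n. cnj (v $ j) * B $$ (j, i) * v $ i)"
    unfolding S_def cnj_sum
  proof (intro sum.cong refl)
    fix i j assume "i \<in> {..<n}" "j \<in> {..<n}"
    then have "cnj (B $$ (i, j)) = B $$ (j, i)" using sym[of j i] by simp
    then show "cnj (cnj (v $ i) * B $$ (i, j) * v $ j) = cnj (v $ j) * B $$ (j, i) * v $ i"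
      by (simp add: mult_ac)
  qed
  also have "\<dots> = S" unfolding S_def by (rule sum.swap)
  finally have "cnj a * of_real r = a * of_real r" unfolding S by simp
  moreover have "r \<noteq> 0"
  proof
    assume "r = 0"
    then have "\<forall>i<n. v $ i = 0" unfolding r_def by (subst (asm) sum_nonneg_eq_0_iff) auto
    with v show False by (auto simp: vec_eq_iff)
  qed
  ultimately have "cnj a = a" by simp
  then show ?thesis by (simp add: complex_eq_iff)
qed

text \<open>The image of \<open>A\<close> under the embedding is a complex Hermitian matrix, so its characteristic
  polynomial splits and has real roots; injectivity of the embedding carries the factorization back.
  The order of the factors is free, so the roots can be listed in decreasing order.\<close>

lemma hermitian_char_poly_splits:
  fixes A :: "'a::real_or_complex mat"
  assumes A: "A \<in> carrier_mat n n" and herm: "mat_adjoint A = A"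
  obtains es :: "real list"
  where "sorted_wrt (\<ge>) es" "length es = n" "char_poly A = (\<Prod>e\<leftarrow>es. [:- of_real e, 1:])"
proof -
  obtain h :: "'a \<Rightarrow> complex" where "inj_idom_hom h"
    and hc: "\<And>x. h (conjugate x) = cnj (h x)" and hr: "\<And>r. h (of_real r) = of_real r"
    by (rule embedding_into_complex) blast
  interpret h: inj_idom_hom h by fact
  interpret hp: map_poly_inj_idom_hom h ..
  let ?B = "map_mat h A"
  have B: "?B \<in> carrier_mat n n" using A by simp
  have hB: "mat_adjoint ?B = ?B"
  proof (rule eq_matI)
    fix i j assume ij: "i < dim_row ?B" "j < dim_col ?B"
    have "h (mat_adjoint A $$ (i, j)) = h (A $$ (i, j))" by (simp only: herm)
    with ij A show "mat_adjoint ?B $$ (i, j) = ?B $$ (i, j)" by (simp add: hc)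
  qed (use A in auto)
  obtain as where as: "char_poly ?B = (\<Prod>a\<leftarrow>as. [:- a, 1:])" "length as = n"
    using char_poly_factorized[OF B] by blast
  define es where "es = rev (sort (map Re as))"
  have real: "a = of_real (Re a)" if "a \<in> set as" for a
    by (rule hermitian_eigenvalue_real[OF B hB])
      (use that in \<open>auto simp: eigenvalue_root_char_poly[OF B] as(1) poly_prod_list prod_list_zero_iff\<close>)
  have m: "mset as = mset (map of_real es)"
  proof -
    have "mset (map of_real es) = mset (map (\<lambda>a. complex_of_real (Re a)) as)"
      unfolding mset_map by (simp add: es_def image_mset.compositionality o_def)
    also have "map (\<lambda>a. complex_of_real (Re a)) as = as"
      using real by (intro map_idI) (simp only:)
    finally show ?thesis by (rule sym)
  qed
  have "char_poly ?B = (\<Prod>e\<leftarrow>es. [:- of_real e, 1:])"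
    unfolding as(1) using arg_cong[OF m, of "\<lambda>M. \<Prod>a\<in>#M. [:- a, 1:]"]
    by (simp flip: prod_mset_prod_list add: image_mset.compositionality o_def)
  also have "\<dots> = map_poly h (\<Prod>e\<leftarrow>es. [:- of_real e, 1:])"
    by (induction es) (simp_all add: h.hom_uminus hr hp.hom_mult del: mult_pCons_left)
  finally have "map_poly h (char_poly A) = map_poly h (\<Prod>e\<leftarrow>es. [:- of_real e, 1:])"
    by (simp only: h.char_poly_hom[OF A])
  then have "char_poly A = (\<Prod>e\<leftarrow>es. [:- of_real e, 1:])"
    by (rule hp.injectivity)
  moreover have "sorted_wrt (\<ge>) es"
    unfolding es_def sorted_wrt_rev by simp
  ultimately show thesis
    using that as(2) by (simp add: es_def)
qed

text \<open>Gram--Schmidt on a basis that starts with \<open>v\<close> gives orthogonal vectors, again starting with \<open>v\<close>;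
  dividing them by their lengths \<open>nrm\<close> makes them orthonormal.\<close>

lemma unitary_with_first_column:
  fixes v :: "'a::real_or_complex vec"
  assumes v: "v \<in> carrier_vec n" "v \<noteq> 0\<^sub>v n"
  obtains Q c where "unitary_mat n Q" "col Q 0 = c \<cdot>\<^sub>v v" "0 < n"
proof -
  interpret cof_vec_space n "TYPE('a)" .
  have n: "0 < n" using v by (cases n) auto
  note bc = basis_completion[OF v]
  define ws where "ws = gram_schmidt n (basis_completion v)"
  note ws = gram_schmidt_result(2-4)[OF bc(2) bc(4) bc(5) ws_def]
  have len: "length ws = n" using ws(3) bc(6) by simp
  have wc: "ws ! j \<in> carrier_vec n" if "j < n" for j using ws(2) that len by auto
  have "basis_completion v = v # tl (basis_completion v)"
    using bc(6,7) n by (cases "basis_completion v") auto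
  then have "hd ws = v" using gram_schmidt_hd[OF v(1)] ws_def by metis
  then have w0: "ws ! 0 = v" using len n by (cases ws) auto
  define nrm where "nrm j = sqrt (\<Sum>i<n. (norm (ws ! j $ i))\<^sup>2)" for j
  have ip: "ws ! j \<bullet>c ws ! i = (\<Sum>k<n. conjugate (ws ! i $ k) * ws ! j $ k)" if "i < n" "j < n" for i j
    using wc[OF that(1)] wc[OF that(2)]
    by (simp add: scalar_prod_def atLeast0LessThan mult.commute)
  have self: "(\<Sum>k<n. conjugate (ws ! j $ k) * ws ! j $ k) = of_real ((nrm j)\<^sup>2)" for j
    unfolding nrm_def mult_conjugate_of_real(2) by (simp add: sum_nonneg)
  have orth: "(\<Sum>k<n. conjugate (ws ! i $ k) * ws ! j $ k) = 0 \<longleftrightarrow> j \<noteq> i" if "i < n" "j < n" for i j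
    using corthogonalD[OF ws(1), of j i] that len by (simp add: ip)
  have nz: "nrm j \<noteq> 0" if "j < n" for j
    using orth[OF that that] self[of j] by auto
  define Q where "Q = mat n n (\<lambda>(i, j). of_real (inverse (nrm j)) * ws ! j $ i)"
  have "mat_adjoint Q * Q = 1\<^sub>m n"
  proof (rule eq_matI)
    fix i j assume "i < dim_row (1\<^sub>m n :: 'a mat)" "j < dim_col (1\<^sub>m n :: 'a mat)"
    then have ij: "i < n" "j < n" by simp_all
    then have "(mat_adjoint Q * Q) $$ (i, j)
        = (\<Sum>k<n. conjugate (of_real (inverse (nrm i)) * ws ! i $ k) * (of_real (inverse (nrm j)) * ws ! j $ k))"
      by (subst index_mult_sum) (auto simp: Q_def)
    also have "\<dots> = of_real (inverse (nrm i)) * of_real (inverse (nrm j))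
        * (\<Sum>k<n. conjugate (ws ! i $ k) * ws ! j $ k)"
      unfolding conjugate_dist_mul conjugate_of_real sum_distrib_left
      by (intro sum.cong refl) (simp only: mult_ac)
    also have "\<dots> = (if i = j then 1 else 0)"
    proof (cases "i = j")
      case True
      have "inverse (nrm i) * inverse (nrm i) * (nrm i)\<^sup>2 = 1"
        using nz[OF ij(1)] by (simp add: power2_eq_square field_simps)
      then have "of_real (inverse (nrm i) * inverse (nrm i) * (nrm i)\<^sup>2) = (1 :: 'a)"
        by (simp only: of_real_1)
      then show ?thesis unfolding True self by (simp only: of_real_mult if_True simp_thms)
    next
      case False
      then show ?thesis using orth[OF ij] by simp
    qed
    finally show "(mat_adjoint Q * Q) $$ (i, j) = (1\<^sub>m n) $$ (i, j)" using ij by simp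
  qed (simp_all add: Q_def)
  then have "unitary_mat n Q" by (intro unitary_matI) (simp_all add: Q_def)
  moreover have "col Q 0 = of_real (inverse (nrm 0)) \<cdot>\<^sub>v v"
    using n w0 v(1) by (intro eq_vecI) (auto simp: Q_def)
  ultimately show thesis using that n by blast
qed

lemma adjoint_four_block_mat:
  fixes A B C D :: "'a::conjugatable_field mat"
  assumes "A \<in> carrier_mat p q" "B \<in> carrier_mat p q'" "C \<in> carrier_mat p' q" "D \<in> carrier_mat p' q'"
  shows "mat_adjoint (four_block_mat A B C D)
    = four_block_mat (mat_adjoint A) (mat_adjoint C) (mat_adjoint B) (mat_adjoint D)"
  using assms by (intro eq_matI) auto

lemma block_diag_mult:
  fixes A1 A2 B1 B2 :: "'a::comm_ring_1 mat"
  assumes "A1 \<in> carrier_mat p p" "A2 \<in> carrier_mat p p" "B1 \<in> carrier_mat q q" "B2 \<in> carrier_mat q q"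
  shows "four_block_mat A1 (0\<^sub>m p q) (0\<^sub>m q p) B1 * four_block_mat A2 (0\<^sub>m p q) (0\<^sub>m q p) B2
    = four_block_mat (A1 * A2) (0\<^sub>m p q) (0\<^sub>m q p) (B1 * B2)"
  using assms by (subst mult_four_block_mat[of _ p p _ q _ q _ _ p _ q]) auto

text \<open>Deflation: in a unitary basis whose first vector is an eigenvector for \<open>e\<close>, the matrix is Hermitian
  with first column \<open>(e, 0, \<dots>, 0)\<close>, hence block diagonal, and the remaining block is Hermitian with
  the remaining roots. Fixing the list \<open>es\<close> in the statement means that the order of the eigenvalues on
  the diagonal can be prescribed, so that no permutation is needed afterwards.\<close>

lemma hermitian_spectral:
  fixes A :: "'a::real_or_complex mat"
  assumes "A \<in> carrier_mat n n" "mat_adjoint A = A" "char_poly A = (\<Prod>e\<leftarrow>es. [:- of_real e, 1:])"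
  shows "\<exists>Q. unitary_mat n Q \<and> A = Q * real_diag n n (\<lambda>i. es ! i) * mat_adjoint Q"
  using assms
proof (induction es arbitrary: n A)
  case Nil
  then have "n = 0" using degree_monic_char_poly[OF Nil(1)] by simp
  then show ?case using Nil(1)
    by (intro exI[of _ "1\<^sub>m 0"]) (auto simp: unitary_mat_def intro!: eq_matI)
next
  case (Cons e es)
  note A = Cons.prems(1) and herm = Cons.prems(2)
  have dA: "dim_row A = n" "dim_col A = n" using A by simp_all
  have "eigenvalue A (of_real e)"
    unfolding eigenvalue_root_char_poly[OF A] Cons.prems(3) by simp
  then obtain v where v: "v \<in> carrier_vec n" "v \<noteq> 0\<^sub>v n" and ev: "A *\<^sub>v v = of_real e \<cdot>\<^sub>v v"
    using A by (auto simp: eigenvalue_def eigenvector_def)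
  obtain Q c where Q: "unitary_mat n Q" and Q0: "col Q 0 = c \<cdot>\<^sub>v v" and n: "0 < n"
    by (rule unitary_with_first_column[OF v])
  note dQ = unitary_matD(1,2)[OF Q]
  define n1 where "n1 = n - 1"
  have n1: "n = Suc n1" using n by (simp add: n1_def)
  define A' where "A' = mat_adjoint Q * A * Q"
  have dA': "dim_row A' = n" "dim_col A' = n" by (simp_all add: A'_def dQ)
  have herm': "mat_adjoint A' = A'"
    by (simp add: A'_def adjoint_mult dQ dA herm mat_assoc_dim)
  have AQ0: "A *\<^sub>v col Q 0 = of_real e \<cdot>\<^sub>v col Q 0"
    unfolding Q0 using v A ev
    by (simp add: mult_mat_vec[OF A v(1)] smult_smult_assoc mult.commute)
  have A'0: "A' $$ (i, 0) = (if i = 0 then of_real e else 0)" if "i < n" for i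
  proof -
    have cQ: "col Q 0 \<in> carrier_vec n" using dQ n by (metis carrier_vec_dim_vec dim_col)
    have "A' $$ (i, 0) = row (mat_adjoint Q) i \<bullet> col (A * Q) 0"
      using that n by (simp add: A'_def mat_assoc_dim dQ dA)
    also have "col (A * Q) 0 = A *\<^sub>v col Q 0"
      by (rule col_mult2[OF A _ n]) (use Q in \<open>simp add: unitary_mat_def\<close>)
    also have "row (mat_adjoint Q) i \<bullet> (A *\<^sub>v col Q 0) = of_real e * (row (mat_adjoint Q) i \<bullet> col Q 0)"
      unfolding AQ0 by (rule scalar_prod_smult_distrib[of _ n]) (use dQ cQ that in \<open>auto intro!: carrier_vecI\<close>)
    also have "row (mat_adjoint Q) i \<bullet> col Q 0 = (mat_adjoint Q * Q) $$ (i, 0)"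
      using that n by (simp add: dQ)
    finally show ?thesis using that n by (simp add: unitary_matD[OF Q])
  qed
  have A'0': "A' $$ (0, i) = (if i = 0 then of_real e else 0)" if "i < n" for i
    using index_adjoint[of 0 A' i] A'0[OF that] that n by (simp add: herm' dA')
  define A3 where "A3 = mat n1 n1 (\<lambda>(i, j). A' $$ (Suc i, Suc j))"
  have A3: "A3 \<in> carrier_mat n1 n1" by (simp add: A3_def)
  define E where "E = mat 1 1 (\<lambda>_. of_real e :: 'a)"
  have E: "E \<in> carrier_mat 1 1" by (simp add: E_def)
  have block: "A' = four_block_mat E (0\<^sub>m 1 n1) (0\<^sub>m n1 1) A3"
    by (rule eq_matI) (auto simp: dA' n1 E_def A3_def A'0 A'0' Suc_diff_le)
  have "similar_mat_wit A A' Q (mat_adjoint Q)"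
    unfolding similar_mat_wit_def Let_def
    using unitary_conj_cancel[OF Q dA] unitary_matD[OF Q] dA dA'
    by (auto simp: A'_def[symmetric] intro!: carrier_matI)
  then have "char_poly A = char_poly A'"
    by (intro char_poly_similar) (auto simp: similar_mat_def)
  also have "\<dots> = char_poly E * char_poly A3"
    unfolding block by (rule char_poly_four_block_zeros_col[OF E _ A3]) simp
  also have "char_poly E = [:- of_real e, 1:]"
    by (simp add: E_def char_poly_defs det_def sign_def)
  finally have "[:- of_real e, 1:] * char_poly A3 = [:- of_real e, 1:] * (\<Prod>e\<leftarrow>es. [:- of_real e, 1:])"
    unfolding Cons.prems(3) by simp
  then have cp: "char_poly A3 = (\<Prod>e\<leftarrow>es. [:- of_real e, 1:])"
    by (metis mult_cancel_left pCons_eq_0_iff zero_neq_one)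
  have "mat_adjoint A3 = A3"
  proof (rule eq_matI)
    fix i j assume "i < dim_row A3" "j < dim_col A3"
    then show "mat_adjoint A3 $$ (i, j) = A3 $$ (i, j)"
      using index_adjoint[of "Suc i" A' "Suc j"] by (simp add: A3_def herm' dA' n1)
  qed (simp_all add: A3_def)
  from Cons.IH[OF A3 this cp] obtain Z where Z: "unitary_mat n1 Z"
    and Z3: "A3 = Z * real_diag n1 n1 (\<lambda>i. es ! i) * mat_adjoint Z" by blast
  define Z' where "Z' = four_block_mat (1\<^sub>m 1) (0\<^sub>m 1 n1) (0\<^sub>m n1 1) Z"
  have cZ: "Z \<in> carrier_mat n1 n1" "mat_adjoint Z \<in> carrier_mat n1 n1"
    using Z by (auto simp: unitary_mat_def)
  have aZ: "mat_adjoint Z' = four_block_mat (1\<^sub>m 1) (0\<^sub>m 1 n1) (0\<^sub>m n1 1) (mat_adjoint Z)"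
    unfolding Z'_def
    by (subst adjoint_four_block_mat[of _ 1 1 _ n1 _ n1])
      (use cZ in \<open>auto simp: zero_mat_real_diag\<close>)
  have dZ': "dim_row Z' = n" "dim_col Z' = n" using cZ by (simp_all add: Z'_def n1)
  have "mat_adjoint Z' * Z' = 1\<^sub>m n"
    unfolding aZ unfolding Z'_def block_diag_mult[OF one_carrier_mat one_carrier_mat cZ(2,1)]
    by (rule eq_matI) (auto simp: unitary_matD[OF Z] n1)
  then have Z': "unitary_mat n Z'" by (intro unitary_matI dZ')
  have D: "real_diag n n (\<lambda>i. (e # es) ! i)
      = four_block_mat E (0\<^sub>m 1 n1) (0\<^sub>m n1 1) (real_diag n1 n1 (\<lambda>i. es ! i))"
    by (rule eq_matI) (auto simp: n1 E_def)
  have cD: "real_diag n1 n1 (\<lambda>i. es ! i) \<in> carrier_mat n1 n1"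
    by (rule carrier_matI) simp_all
  have "A' = Z' * real_diag n n (\<lambda>i. (e # es) ! i) * mat_adjoint Z'"
    unfolding D aZ unfolding Z'_def block
      block_diag_mult[OF one_carrier_mat E cZ(1) cD]
      block_diag_mult[OF mult_carrier_mat[OF one_carrier_mat E] one_carrier_mat
        mult_carrier_mat[OF cZ(1) cD] cZ(2)] Z3[symmetric]
    using E by simp
  then have "A = Q * (Z' * real_diag n n (\<lambda>i. (e # es) ! i) * mat_adjoint Z') * mat_adjoint Q"
    using unitary_conj_cancel[OF Q dA] by (simp add: A'_def)
  also have "\<dots> = (Q * Z') * real_diag n n (\<lambda>i. (e # es) ! i) * mat_adjoint (Q * Z')"
    by (simp add: adjoint_mult mat_assoc_dim dQ dZ')
  finally show ?case using unitary_mat_mult[OF Q Z'] by blast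
qed

section \<open>Singular value decompositions\<close>

text \<open>Applied to a sorted list, this says that the indices of the large entries form an initial segment.\<close>

lemma down_closed_initial_segment:
  fixes S :: "nat set"
  assumes "S \<subseteq> {..<p}" "\<And>i j. i \<in> S \<Longrightarrow> j < i \<Longrightarrow> j \<in> S"
  obtains r where "S = {..<r}" "r \<le> p"
proof -
  define r where "r = (LEAST i. i \<notin> S)"
  have p: "p \<notin> S" using assms(1) by auto
  then have "r \<notin> S" unfolding r_def by (rule LeastI)
  moreover have "i \<in> S" if "i < r" for i using not_less_Least[of i] that unfolding r_def by blast
  ultimately have "S = {..<r}" using assms(2) by (metis lessThan_iff linorder_neqE_nat subsetI subset_antisym)
  moreover have "r \<le> p" unfolding r_def using p by (rule Least_le)
  ultimately show thesis using that by blast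
qed

lemma trace_mult_commute:
  fixes F G :: "'a::comm_ring_1 mat"
  assumes "dim_row F = p" "dim_col F = r" "dim_row G = r" "dim_col G = p"
  shows "(\<Sum>i<p. (F * G) $$ (i, i)) = (\<Sum>k<r. (G * F) $$ (k, k))"
proof -
  have "(\<Sum>i<p. (F * G) $$ (i, i)) = (\<Sum>i<p. \<Sum>k<r. F $$ (i, k) * G $$ (k, i))"
    using assms by (intro sum.cong refl, subst index_mult_sum) auto
  also have "\<dots> = (\<Sum>k<r. \<Sum>i<p. G $$ (k, i) * F $$ (i, k))"
    by (subst sum.swap) (simp only: mult.commute)
  also have "\<dots> = (\<Sum>k<r. (G * F) $$ (k, k))"
    using assms by (intro sum.cong refl, subst index_mult_sum) auto
  finally show ?thesis .
qed

text \<open>The spectral theorem for the projection \<open>P = X * X\<^sup>*\<close> gives a unitary \<open>Z\<close> and eigenvalues \<open>1\<close>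
  (the first \<open>t\<close>) and \<open>0\<close>. Comparing traces gives \<open>t = r\<close>, so the last \<open>p - r\<close> columns of \<open>Z\<close> lie in the
  kernel of \<open>P\<close>, which is the orthogonal complement of the columns of \<open>X\<close>; they complete \<open>X\<close>.\<close>

lemma orthonormal_completion:
  fixes X :: "'a::real_or_complex mat"
  assumes X: "X \<in> carrier_mat p r" and orth: "mat_adjoint X * X = 1\<^sub>m r"
  obtains W where "unitary_mat p W" "\<And>i j. i < p \<Longrightarrow> j < r \<Longrightarrow> W $$ (i, j) = X $$ (i, j)" "r \<le> p"
proof -
  have dX: "dim_row X = p" "dim_col X = r" using X by auto
  define P where "P = X * mat_adjoint X"
  have P: "P \<in> carrier_mat p p" and herm: "mat_adjoint P = P"
    using dX by (auto simp: P_def adjoint_mult)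
  obtain es where es: "sorted_wrt (\<ge>) es" "length es = p"
    and cp: "char_poly P = (\<Prod>e\<leftarrow>es. [:- of_real e, 1:])"
    by (rule hermitian_char_poly_splits[OF P herm])
  define D :: "'a mat" where "D = real_diag p p (\<lambda>i. es ! i)"
  obtain Z where Z: "unitary_mat p Z" and PZ: "P = Z * D * mat_adjoint Z"
    using hermitian_spectral[OF P herm cp] unfolding D_def by blast
  note dZ = unitary_matD(1,2)[OF Z]
  have dD: "dim_row D = p" "dim_col D = p" by (simp_all add: D_def)
  have idem: "P * P = P"
    by (simp add: P_def dX mat_assoc_dim mat_assoc_cancel[OF orth])
  have conj: "mat_adjoint Z * P * Z = D"
    unfolding PZ by (simp add: dZ dD mat_assoc_dim mat_assoc_cancel[OF unitary_matD(3)[OF Z]] unitary_matD(3)[OF Z])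
  have dP: "dim_row P = p" "dim_col P = p" using P by auto
  have "D * D = mat_adjoint Z * (P * P) * Z"
    unfolding conj[symmetric]
    by (simp add: dZ dP mat_assoc_dim mat_assoc_cancel[OF unitary_matD(4)[OF Z]])
  then have DD: "D * D = D" by (simp only: idem conj)
  have e01: "es ! i = 0 \<or> es ! i = 1" if "i < p" for i
  proof -
    have "(D * D) $$ (i, i) = D $$ (i, i)" by (simp only: DD)
    then have "of_real (es ! i * es ! i) = (of_real (es ! i) :: 'a)"
      using that unfolding D_def real_diag_mult by simp
    then have "es ! i * es ! i = es ! i" by (simp only: of_real_eq_iff)
    then show ?thesis by simp
  qed
  have mono: "es ! j \<le> es ! i" if "i \<le> j" "j < p" for i j
    using es that by (metis le_neq_implies_less order_refl sorted_wrt_nth_less)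
  obtain t where t: "{i. i < p \<and> es ! i = 1} = {..<t}" "t \<le> p"
  proof (rule down_closed_initial_segment[of "{i. i < p \<and> es ! i = 1}" p])
    fix i j assume "i \<in> {i. i < p \<and> es ! i = 1}" "j < i"
    then show "j \<in> {i. i < p \<and> es ! i = 1}" using mono[of j i] e01[of j] by force
  qed auto
  have eq: "es ! i = (if i < t then 1 else 0)" if "i < p" for i
    using e01[OF that] that t(1) by force
  have "(\<Sum>i<p. P $$ (i, i)) = (\<Sum>k<r. (mat_adjoint X * X) $$ (k, k))"
    unfolding P_def by (rule trace_mult_commute) (simp_all add: dX)
  then have "(\<Sum>i<p. P $$ (i, i)) = of_nat r" by (simp add: orth)
  moreover have "(\<Sum>i<p. P $$ (i, i)) = (\<Sum>k<p. (mat_adjoint Z * (Z * D)) $$ (k, k))"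
    unfolding PZ by (rule trace_mult_commute) (simp_all add: dZ dD)
  moreover have "mat_adjoint Z * (Z * D) = D"
    by (simp add: mat_assoc_cancel[OF unitary_matD(3)[OF Z]] dZ dD)
  moreover have "(\<Sum>k<p. D $$ (k, k)) = (\<Sum>k<p. if k < t then 1 else 0)"
    by (rule sum.cong) (simp_all add: D_def eq)
  moreover have "(\<Sum>k<p. if k < t then 1 else 0) = (of_nat t :: 'a)"
  proof -
    have "{..<p} \<inter> {k. k < t} = {..<t}" using t(2) by auto
    then show ?thesis by (simp add: sum.If_cases)
  qed
  ultimately have rt: "r = t" by simp
  have XZ: "(mat_adjoint X * Z) $$ (j, l) = 0" if "j < r" "r \<le> l" "l < p" for j l
  proof -
    have "mat_adjoint X * Z = mat_adjoint X * (P * Z)"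
      by (simp add: P_def dX dZ mat_assoc_dim mat_assoc_cancel[OF orth])
    also have "P * Z = Z * D"
      unfolding PZ by (simp add: dZ dD mat_assoc_dim unitary_matD(3)[OF Z])
    also have "mat_adjoint X * (Z * D) = (mat_adjoint X * Z) * D"
      by (simp add: dX dZ dD mat_assoc_dim)
    finally have "mat_adjoint X * Z = (mat_adjoint X * Z) * D" .
    then have "(mat_adjoint X * Z) $$ (j, l) = ((mat_adjoint X * Z) * D) $$ (j, l)" by (rule arg_cong)
    also have "\<dots> = (mat_adjoint X * Z) $$ (j, l) * of_real (es ! l)"
      using that unfolding D_def by (subst index_mult_real_diag) (simp_all add: dX dZ)
    also have "es ! l = 0" using eq[of l] that rt by simp
    finally show ?thesis by simp
  qed
  have ZX: "(mat_adjoint Z * X) $$ (l, j) = 0" if "j < r" "r \<le> l" "l < p" for j l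
  proof -
    have "mat_adjoint Z * X = mat_adjoint (mat_adjoint X * Z)" by (simp add: adjoint_mult dX dZ)
    then show ?thesis using XZ[OF that] that by (simp add: dX dZ del: index_mult_mat(1))
  qed
  define W where "W = mat p p (\<lambda>(i, j). if j < r then X $$ (i, j) else Z $$ (i, j))"
  have "mat_adjoint W * W = 1\<^sub>m p"
  proof (rule eq_matI)
    fix i j assume "i < dim_row (1\<^sub>m p :: 'a mat)" "j < dim_col (1\<^sub>m p :: 'a mat)"
    then have ij: "i < p" "j < p" by simp_all
    define F where "F i = (if i < r then X else Z)" for i
    have "(mat_adjoint W * W) $$ (i, j) = (\<Sum>k<p. conjugate (W $$ (k, i)) * W $$ (k, j))"
      using ij by (subst index_mult_sum) (auto simp: W_def)
    also have "\<dots> = (\<Sum>k<p. conjugate (F i $$ (k, i)) * F j $$ (k, j))"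
      using ij by (intro sum.cong) (auto simp: W_def F_def)
    also have "\<dots> = (mat_adjoint (F i) * F j) $$ (i, j)"
      using ij by (subst index_mult_sum) (auto simp: F_def dX dZ)
    also have "\<dots> = 1\<^sub>m p $$ (i, j)"
      using ij XZ[of i j] ZX[of j i]
      by (auto simp: F_def orth unitary_matD(3)[OF Z] simp del: index_mult_mat(1))
    finally show "(mat_adjoint W * W) $$ (i, j) = 1\<^sub>m p $$ (i, j)" .
  qed (simp_all add: W_def)
  then have "unitary_mat p W" by (intro unitary_matI) (simp_all add: W_def)
  then show thesis using that[of W] rt t(2) by (simp add: W_def)
qed

text \<open>If \<open>B\<^sup>* * B = V * D * V\<^sup>*\<close>, then the columns of \<open>Y = B * V\<close> are orthogonal with squared lengths on
  the diagonal of \<open>D\<close>. The nonzero ones, normalized and completed to a unitary matrix, are the left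
  singular vectors.\<close>

theorem svd_exists:
  fixes B :: "'a::real_or_complex mat"
  shows "\<exists>W s V. is_svd B W s V"
proof -
  define p q where "p = dim_row B" and "q = dim_col B"
  have dB: "dim_row B = p" "dim_col B = q" by (simp_all add: p_def q_def)
  define M where "M = mat_adjoint B * B"
  have M: "M \<in> carrier_mat q q" and herm: "mat_adjoint M = M"
    using dB by (auto simp: M_def adjoint_mult)
  obtain ds where ds: "sorted_wrt (\<ge>) ds" "length ds = q"
    and cp: "char_poly M = (\<Prod>e\<leftarrow>ds. [:- of_real e, 1:])"
    by (rule hermitian_char_poly_splits[OF M herm])
  define D :: "'a mat" where "D = real_diag q q (\<lambda>i. ds ! i)"
  obtain V where V: "unitary_mat q V" and MV: "M = V * D * mat_adjoint V"
    using hermitian_spectral[OF M herm cp] unfolding D_def by blast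
  note dV = unitary_matD(1,2)[OF V]
  have dD: "dim_row D = q" "dim_col D = q" by (simp_all add: D_def)
  define Y where "Y = B * V"
  have dY: "dim_row Y = p" "dim_col Y = q" by (simp_all add: Y_def dB dV)
  have "mat_adjoint Y * Y = mat_adjoint V * M * V"
    by (simp add: Y_def M_def adjoint_mult mat_assoc_dim dB dV)
  also have "\<dots> = D"
    unfolding MV by (simp add: dV dD mat_assoc_dim mat_assoc_cancel[OF unitary_matD(3)[OF V]] unitary_matD(3)[OF V])
  finally have YY: "mat_adjoint Y * Y = D" .
  have YYij: "(\<Sum>k<p. conjugate (Y $$ (k, i)) * Y $$ (k, j)) = (if i = j then of_real (ds ! i) else 0)"
    if "i < q" "j < q" for i j
  proof -
    have "(\<Sum>k<p. conjugate (Y $$ (k, i)) * Y $$ (k, j)) = (mat_adjoint Y * Y) $$ (i, j)"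
      using that by (subst index_mult_sum) (auto simp: dY)
    then show ?thesis using that by (simp add: YY D_def)
  qed
  have dsn: "ds ! j = (\<Sum>k<p. (norm (Y $$ (k, j)))\<^sup>2)" if "j < q" for j
  proof -
    have "of_real (ds ! j) = (of_real (\<Sum>k<p. (norm (Y $$ (k, j)))\<^sup>2) :: 'a)"
      unfolding of_real_sum mult_conjugate_of_real(2)[symmetric] using YYij[OF that that] by simp
    then show ?thesis by (simp only: of_real_eq_iff)
  qed
  have ds0: "0 \<le> ds ! j" if "j < q" for j unfolding dsn[OF that] by (rule sum_nonneg) simp
  have Y0: "Y $$ (i, j) = 0" if "ds ! j = 0" "i < p" "j < q" for i j
    using that unfolding dsn[OF that(3)] by (subst (asm) sum_nonneg_eq_0_iff) auto
  have mono: "ds ! j \<le> ds ! i" if "i \<le> j" "j < q" for i j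
    using ds that by (metis le_neq_implies_less order_refl sorted_wrt_nth_less)
  obtain r where r: "{i. i < q \<and> 0 < ds ! i} = {..<r}" "r \<le> q"
  proof (rule down_closed_initial_segment[of "{i. i < q \<and> 0 < ds ! i}" q])
    fix i j assume "i \<in> {i. i < q \<and> 0 < ds ! i}" "j < i"
    then show "j \<in> {i. i < q \<and> 0 < ds ! i}" using mono[of j i] by force
  qed auto
  have pos: "0 < ds ! j" if "j < r" for j using that r(1) by blast
  have zero: "ds ! j = 0" if "r \<le> j" "j < q" for j
  proof -
    have "j \<notin> {i. i < q \<and> 0 < ds ! i}" unfolding r(1) using that(1) by simp
    then show ?thesis using ds0[OF that(2)] that(2) by simp
  qed
  define X where "X = mat p r (\<lambda>(i, j). of_real (inverse (sqrt (ds ! j))) * Y $$ (i, j))"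
  have X: "X \<in> carrier_mat p r" by (simp add: X_def)
  have "mat_adjoint X * X = 1\<^sub>m r"
  proof (rule eq_matI)
    fix i j assume "i < dim_row (1\<^sub>m r :: 'a mat)" "j < dim_col (1\<^sub>m r :: 'a mat)"
    then have ij: "i < r" "j < r" "i < q" "j < q" using r(2) by simp_all
    then have "(mat_adjoint X * X) $$ (i, j) = (\<Sum>k<p. conjugate (of_real (inverse (sqrt (ds ! i))) * Y $$ (k, i))
        * (of_real (inverse (sqrt (ds ! j))) * Y $$ (k, j)))"
      by (subst index_mult_sum) (auto simp: X_def)
    also have "\<dots> = of_real (inverse (sqrt (ds ! i))) * of_real (inverse (sqrt (ds ! j)))
        * (\<Sum>k<p. conjugate (Y $$ (k, i)) * Y $$ (k, j))"
      unfolding conjugate_dist_mul conjugate_of_real sum_distrib_left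
      by (intro sum.cong refl) (simp only: mult_ac)
    also have "\<dots> = (if i = j then of_real (inverse (sqrt (ds ! i)) * inverse (sqrt (ds ! i)) * ds ! i) else 0)"
      unfolding YYij[OF ij(3,4)] by (simp del: of_real_inverse)
    also have "inverse (sqrt (ds ! i)) * inverse (sqrt (ds ! i)) * ds ! i = 1"
      using pos[OF ij(1)] by (simp add: field_simps)
    finally show "(mat_adjoint X * X) $$ (i, j) = 1\<^sub>m r $$ (i, j)" using ij by simp
  qed (simp_all add: X_def)
  from orthonormal_completion[OF X this] obtain W where W: "unitary_mat p W" and rp: "r \<le> p"
    and WX: "\<And>i j. i < p \<Longrightarrow> j < r \<Longrightarrow> W $$ (i, j) = X $$ (i, j)" by blast
  note dW = unitary_matD(1,2)[OF W]
  define s where "s = map (\<lambda>j. sqrt (ds ! j)) [0..<min p q]"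
  have YW: "Y = W * rect_diag p q s"
  proof (rule eq_matI)
    fix i j assume "i < dim_row (W * rect_diag p q s)" "j < dim_col (W * rect_diag p q s)"
    then have ij: "i < p" "j < q" by (simp_all add: dW rect_diag_eq_real_diag)
    have "(W * rect_diag p q s) $$ (i, j) = (if j < p then W $$ (i, j) * of_real (s ! j) else 0)"
      unfolding rect_diag_eq_real_diag using ij by (intro index_mult_real_diag) (simp_all add: dW)
    also have "\<dots> = Y $$ (i, j)"
    proof (cases "j < r")
      case True
      have "of_real (inverse (sqrt (ds ! j)) * sqrt (ds ! j)) = (of_real 1 :: 'a)"
        using pos[OF True] by (intro arg_cong[of _ _ of_real]) simp
      then have "of_real (inverse (sqrt (ds ! j))) * of_real (sqrt (ds ! j)) = (1 :: 'a)"
        by (simp only: of_real_mult of_real_1)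
      moreover have "W $$ (i, j) * of_real (s ! j)
          = of_real (inverse (sqrt (ds ! j))) * of_real (sqrt (ds ! j)) * Y $$ (i, j)"
        using True ij rp r(2) by (simp add: WX X_def s_def del: of_real_inverse)
      ultimately show ?thesis using True rp by simp
    next
      case False
      then have "ds ! j = 0" using zero ij by simp
      then show ?thesis using Y0[OF _ ij] ij by (simp add: s_def)
    qed
    finally show "Y $$ (i, j) = (W * rect_diag p q s) $$ (i, j)" by (rule sym)
  qed (simp_all add: dW dY rect_diag_eq_real_diag)
  have BY: "B = Y * mat_adjoint V"
    by (simp add: Y_def mat_assoc_dim dB dV unitary_matD(4)[OF V])
  have "length s = min p q" by (simp add: s_def)
  moreover have "sorted_wrt (\<ge>) s"
    unfolding sorted_wrt_iff_nth_less by (auto simp: s_def intro!: mono)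
  moreover have "\<forall>x\<in>set s. 0 \<le> x" using ds0 by (auto simp: s_def)
  ultimately have "is_svd B W s V"
    unfolding is_svd_def dB using W V BY[unfolded YW] by blast
  then show ?thesis by blast
qed

text \<open>The right inverse of \<open>G\<close> shows that \<open>F * G\<close> and \<open>F\<close> have the same column space, and the left
  inverse of \<open>F\<close> shows that the columns of \<open>F\<close> are independent.\<close>

lemma mat_rank_factorization:
  fixes F G :: "'a::field mat"
  assumes F: "F \<in> carrier_mat p r" and G: "G \<in> carrier_mat r q"
    and F': "F' \<in> carrier_mat r p" "F' * F = 1\<^sub>m r"
    and G': "G' \<in> carrier_mat q r" "G * G' = 1\<^sub>m r"
  shows "mat_rank (F * G) = r"
proof -
  interpret vec_space "TYPE('a)" p .
  have inj: "v = w" if "v \<in> carrier_vec r" "w \<in> carrier_vec r" "F *\<^sub>v v = F *\<^sub>v w" for v w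
  proof -
    have "F' *\<^sub>v (F *\<^sub>v v) = F' *\<^sub>v (F *\<^sub>v w)" by (simp only: that(3))
    then show ?thesis using that(1,2) F F'
      by (metis assoc_mult_mat_vec one_mult_mat_vec)
  qed
  have colF: "col F j = F *\<^sub>v unit_vec r j" if "j < r" for j
    using F that by (intro eq_vecI) (auto simp: scalar_prod_right_unit[of _ r])
  have dist: "distinct (cols F)"
    unfolding distinct_conv_nth
  proof (intro allI impI notI)
    fix i j assume ij: "i < length (cols F)" "j < length (cols F)" "i \<noteq> j" and eq: "cols F ! i = cols F ! j"
    then have ij': "i < r" "j < r" using F by auto
    then have "F *\<^sub>v unit_vec r i = F *\<^sub>v unit_vec r j"
      using eq ij by (simp add: colF[symmetric])
    then have "unit_vec r i = (unit_vec r j :: 'a vec)" using inj by simp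
    then have "unit_vec r i $ i = (unit_vec r j $ i :: 'a)" by simp
    then show False using ij ij' by simp
  qed
  have "\<not> lin_dep (set (cols F))"
  proof
    assume "lin_dep (set (cols F))"
    then obtain v where v: "v \<in> carrier_vec r" "v \<noteq> 0\<^sub>v r" "F *\<^sub>v v = 0\<^sub>v p"
      using lin_depE[OF F _ dist] by blast
    have "F *\<^sub>v 0\<^sub>v r = 0\<^sub>v p" using F by (intro eq_vecI) auto
    then show False using inj[OF v(1) zero_carrier_vec] v by simp
  qed
  then have rF: "rank F = r" by (rule lin_indpt_full_rank[OF F dist])
  have FG: "F * G \<in> carrier_mat p q" using F G by simp
  have "col_space (F * G) = col_space F"
  proof (intro subset_antisym subsetI)
    fix y assume "y \<in> col_space (F * G)"
    then obtain x where "x \<in> carrier_vec q" "y = F *\<^sub>v (G *\<^sub>v x)"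
      using F G by (auto simp: col_space_eq[OF FG])
    moreover from this have "G *\<^sub>v x \<in> carrier_vec r" using G by auto
    ultimately show "y \<in> col_space F" using F by (auto simp: col_space_eq[OF F])
  next
    fix y assume "y \<in> col_space F"
    then obtain x where x: "x \<in> carrier_vec r" "y = F *\<^sub>v x"
      using F by (auto simp: col_space_eq[OF F])
    then have "x = G *\<^sub>v (G' *\<^sub>v x)" using G G' by (metis assoc_mult_mat_vec one_mult_mat_vec)
    then have "y = (F * G) *\<^sub>v (G' *\<^sub>v x)"
      using x F G G' by (metis assoc_mult_mat_vec mult_mat_vec_carrier)
    moreover have "G' *\<^sub>v x \<in> carrier_vec q" using G' x by auto
    ultimately show "y \<in> col_space (F * G)" using F G by (auto simp: col_space_eq[OF FG])
  qed
  then have "rank (F * G) = rank F" unfolding rank_def col_space_def by simp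
  then show ?thesis using rF F by (simp add: mat_rank_def)
qed

text \<open>The outer factors \<open>W\<close> and \<open>V\<^sup>*\<close> have one-sided inverses and the diagonal is invertible, so the
  factorization itself determines the rank of \<open>B\<close>.\<close>

lemma is_compact_svdI:
  fixes B :: "'a::real_or_complex mat"
  assumes W: "W \<in> carrier_mat p r" "mat_adjoint W * W = 1\<^sub>m r"
    and V: "V \<in> carrier_mat q r" "mat_adjoint V * V = 1\<^sub>m r"
    and s: "length s = r" "sorted_wrt (\<ge>) s" "\<forall>x\<in>set s. 0 < x"
    and B: "B = W * rect_diag r r s * mat_adjoint V"
  shows "is_compact_svd B W s V"
proof -
  define D D' :: "'a mat" where "D = rect_diag r r s" and "D' = real_diag r r (\<lambda>i. inverse (s ! i))"
  have d: "dim_row W = p" "dim_col W = r" "dim_row V = q" "dim_col V = r"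
    "dim_row D = r" "dim_col D = r" "dim_row D' = r" "dim_col D' = r"
    using W V by (auto simp: D_def D'_def rect_diag_eq_real_diag)
  have "D * D' = 1\<^sub>m r"
    unfolding D_def D'_def rect_diag_eq_real_diag real_diag_mult one_mat_real_diag
  proof (rule real_diag_cong)
    fix i assume "i < r"
    then have "s ! i \<noteq> 0" using s(1,3) nth_mem[of i s] by force
    then show "(if i < r then s ! i * inverse (s ! i) else 0) = 1" using \<open>i < r\<close> by simp
  qed
  then have inv: "D * mat_adjoint V * (V * D') = 1\<^sub>m r"
    by (simp add: d mat_assoc_dim mat_assoc_cancel[OF V(2)])
  have "mat_rank (W * (D * mat_adjoint V)) = r"
    by (rule mat_rank_factorization[OF W(1) _ _ W(2) _ inv]) (use d in auto)
  then have "mat_rank B = r" unfolding B D_def[symmetric] by (simp add: mat_assoc_dim d)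
  moreover have "dim_row B = p" "dim_col B = q" by (simp_all add: B d)
  ultimately show ?thesis
    unfolding is_compact_svd_def orthonormal_cols_def using W V s B d by simp
qed

lemma is_compact_svdD:
  assumes "is_compact_svd B W s V"
  defines "r \<equiv> mat_rank B"
  shows "W \<in> carrier_mat (dim_row B) r" "mat_adjoint W * W = 1\<^sub>m r"
    "V \<in> carrier_mat (dim_col B) r" "mat_adjoint V * V = 1\<^sub>m r"
    "length s = r" "sorted_wrt (\<ge>) s" "\<forall>x\<in>set s. 0 < x"
    "B = W * rect_diag r r s * mat_adjoint V"
  using assms unfolding is_compact_svd_def orthonormal_cols_def by auto

text \<open>A compact SVD keeps those columns of a full SVD that belong to the \<open>r\<close> positive singular values.
  The truncated identities \<open>K\<close> and \<open>H\<close> select these columns.\<close>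

lemma compact_svd_exists:
  fixes B :: "'a::real_or_complex mat"
  obtains W s V where "is_compact_svd B W s V"
proof -
  define p q where "p = dim_row B" and "q = dim_col B"
  obtain W s V where W: "unitary_mat p W" and V: "unitary_mat q V"
    and s: "length s = min p q" "sorted_wrt (\<ge>) s" "\<forall>x\<in>set s. 0 \<le> x"
    and B: "B = W * rect_diag p q s * mat_adjoint V"
    using svd_exists[of B] unfolding is_svd_def p_def[symmetric] q_def[symmetric] by blast
  have d: "dim_row W = p" "dim_col W = p" "dim_row V = q" "dim_col V = q"
    using W V by (auto simp: unitary_mat_def)
  have mono: "s ! j \<le> s ! i" if "i \<le> j" "j < min p q" for i j
    using s that by (metis le_neq_implies_less order_refl sorted_wrt_nth_less)
  obtain r where r: "{i. i < min p q \<and> 0 < s ! i} = {..<r}" "r \<le> min p q"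
  proof (rule down_closed_initial_segment[of "{i. i < min p q \<and> 0 < s ! i}" "min p q"])
    fix i j assume "i \<in> {i. i < min p q \<and> 0 < s ! i}" "j < i"
    then show "j \<in> {i. i < min p q \<and> 0 < s ! i}" using mono[of j i] by force
  qed auto
  have pos: "0 < s ! j" if "j < r" for j using that r(1) by blast
  have zero: "s ! j = 0" if "r \<le> j" "j < min p q" for j
  proof -
    have "j \<notin> {i. i < min p q \<and> 0 < s ! i}" unfolding r(1) using that(1) by simp
    moreover have "0 \<le> s ! j" using s(1,3) that(2) by simp
    ultimately show ?thesis using that(2) by simp
  qed
  define K H :: "'a mat" where "K = real_diag p r (\<lambda>_. 1)" and "H = real_diag q r (\<lambda>_. 1)"
  have dK: "dim_row K = p" "dim_col K = r" "dim_row H = q" "dim_col H = r"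
    by (simp_all add: K_def H_def)
  have KK: "mat_adjoint K * K = 1\<^sub>m r" "mat_adjoint H * H = 1\<^sub>m r"
    unfolding K_def H_def adjoint_real_diag real_diag_mult one_mat_real_diag
    using r(2) by (auto intro!: real_diag_cong)
  have "K * rect_diag r r (take r s) * mat_adjoint H = rect_diag p q s"
    unfolding K_def H_def adjoint_real_diag rect_diag_eq_real_diag real_diag_mult
    using zero by (auto intro!: real_diag_cong)
  then have "B = W * (K * rect_diag r r (take r s) * mat_adjoint H) * mat_adjoint V"
    by (simp only: B)
  then have "B = (W * K) * rect_diag r r (take r s) * mat_adjoint (V * H)"
    by (simp add: mat_assoc_dim adjoint_mult d dK rect_diag_eq_real_diag)
  moreover have "mat_adjoint (W * K) * (W * K) = 1\<^sub>m r" "mat_adjoint (V * H) * (V * H) = 1\<^sub>m r"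
    using KK by (simp_all add: mat_assoc_dim adjoint_mult d dK
        mat_assoc_cancel[OF unitary_matD(3)[OF W]] mat_assoc_cancel[OF unitary_matD(3)[OF V]])
  moreover have "\<forall>x\<in>set (take r s). 0 < x"
    using pos r(2) s(1) by (auto simp: in_set_conv_nth)
  moreover have "sorted_wrt (\<ge>) (take r s)" using s(2) by (rule sorted_wrt_take)
  moreover have "length (take r s) = r" using r(2) s(1) by simp
  moreover have "W * K \<in> carrier_mat p r" "V * H \<in> carrier_mat q r"
    by (auto simp: d dK)
  ultimately show thesis using is_compact_svdI that by blast
qed

text \<open>A compact SVD \<open>P * D * Q\<^sup>*\<close> of the product \<open>F * H\<close> makes the square matrices
  \<open>D' * P\<^sup>* * F\<close> and \<open>H * Q\<close> inverse to each other, where \<open>D' * D = 1\<close>; reading the product of the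
  two in the other order exhibits the one-sided inverses.\<close>

lemma full_rank_product_factors_invertible:
  fixes F H :: "'a::real_or_complex mat"
  assumes F: "F \<in> carrier_mat a k" and H: "H \<in> carrier_mat k b" and rank: "mat_rank (F * H) = k"
  shows "\<exists>F' H'. F' \<in> carrier_mat k a \<and> F' * F = 1\<^sub>m k \<and> H' \<in> carrier_mat b k \<and> H * H' = 1\<^sub>m k"
proof -
  obtain P s Q where svd: "is_compact_svd (F * H) P s Q" by (rule compact_svd_exists)
  note c = is_compact_svdD[OF svd, unfolded rank]
  define D D' :: "'a mat" where "D = real_diag k k (\<lambda>i. s ! i)" and "D' = real_diag k k (\<lambda>i. inverse (s ! i))"
  have d: "dim_row P = a" "dim_col P = k" "dim_row Q = b" "dim_col Q = k" "dim_row F = a" "dim_col F = k"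
    "dim_row H = k" "dim_col H = b" "dim_row D = k" "dim_col D = k" "dim_row D' = k" "dim_col D' = k"
    using c(1,3) F H by (auto simp: D_def D'_def)
  have D'D: "D' * D = 1\<^sub>m k"
    unfolding D_def D'_def real_diag_mult one_mat_real_diag
  proof (rule real_diag_cong)
    fix i assume "i < k"
    then have "s ! i \<noteq> 0" using c(5,7) nth_mem[of i s] by force
    then show "(if i < k then inverse (s ! i) * s ! i else 0) = 1" using \<open>i < k\<close> by simp
  qed
  have FH: "F * H = P * D * mat_adjoint Q" using c(8) by (simp only: D_def rect_diag_eq_real_diag)
  define K where "K = D' * mat_adjoint P"
  have dK: "dim_row K = k" "dim_col K = a" by (simp_all add: K_def d)
  have "(K * F) * (H * Q) = K * (F * H) * Q" by (simp add: mat_assoc_dim d dK)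
  also have "\<dots> = 1\<^sub>m k"
    unfolding FH K_def by (simp add: mat_assoc_dim d mat_assoc_cancel[OF c(2)] mat_assoc_cancel[OF D'D] c(4) D'D)
  finally have lr: "(K * F) * (H * Q) = 1\<^sub>m k" .
  then have rl: "(H * Q) * (K * F) = 1\<^sub>m k"
    by (rule mat_mult_left_right_inverse[rotated 2]) (auto simp: d dK)
  have "H * Q * K * F = 1\<^sub>m k" using rl by (simp add: mat_assoc_dim d dK)
  moreover have "H * (Q * (K * F)) = 1\<^sub>m k" using rl by (simp add: mat_assoc_dim d dK)
  moreover have "H * Q * K \<in> carrier_mat k a" "Q * (K * F) \<in> carrier_mat b k" by (auto simp: d dK)
  ultimately show ?thesis by blast
qed

section \<open>Pseudoinverses and truncation\<close>

text \<open>The products \<open>B * X\<close> and \<open>B * Y\<close> absorb each other, and being self-adjoint they coincide; the same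
  holds for \<open>X * B\<close> and \<open>Y * B\<close>.\<close>

lemma moore_penrose_unique:
  fixes B X Y :: "'a::conjugatable_field mat"
  assumes X: "moore_penrose B X" and Y: "moore_penrose B Y"
  shows "X = Y"
proof -
  note X' = X[unfolded moore_penrose_def] and Y' = Y[unfolded moore_penrose_def]
  have d: "dim_row X = dim_col B" "dim_col X = dim_row B" "dim_row Y = dim_col B" "dim_col Y = dim_row B"
    using X' Y' by auto
  have "B * X = B * Y * (B * X)"
    using Y' by (simp add: d mat_assoc_dim[symmetric])
  also have "\<dots> = mat_adjoint (B * X * (B * Y))"
    using X' Y' by (simp add: adjoint_mult[of "B * X" "B * Y"] d)
  also have "B * X * (B * Y) = B * Y"
    using X' by (simp add: d mat_assoc_dim[symmetric])
  finally have BX: "B * X = B * Y" using Y' by simp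
  have "X * B = X * B * (Y * B)"
    using Y' by (simp add: d mat_assoc_dim)
  also have "\<dots> = mat_adjoint (Y * B * (X * B))"
    using X' Y' by (simp add: adjoint_mult[of "Y * B" "X * B"] d)
  also have "Y * B * (X * B) = Y * B"
    using X' by (simp add: d mat_assoc_dim)
  finally have XB: "X * B = Y * B" using Y' by simp
  have "X = X * (B * X)" using X' by (simp add: d mat_assoc_dim)
  also have "\<dots> = X * B * Y" unfolding BX by (simp add: d mat_assoc_dim)
  also have "\<dots> = Y" unfolding XB using Y' by simp
  finally show ?thesis .
qed

lemma pinv_eqI: "moore_penrose B X \<Longrightarrow> pinv B = X"
  unfolding pinv_def using moore_penrose_unique by (intro the_equality) blast+

text \<open>A pseudoinverse inverts the nonzero diagonal entries and keeps the zero ones, which is what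
  \<open>inverse\<close> does, because \<open>inverse 0 = 0\<close>.\<close>

lemma moore_penrose_unitary_diag:
  fixes W V :: "'a::real_or_complex mat"
  assumes W: "unitary_mat p W" and V: "unitary_mat q V"
  shows "moore_penrose (W * real_diag p q f * mat_adjoint V)
    (V * real_diag q p (\<lambda>i. inverse (f i)) * mat_adjoint W)"
proof -
  define D D' :: "'a mat" where "D = real_diag p q f" and "D' = real_diag q p (\<lambda>i. inverse (f i))"
  have d: "dim_row W = p" "dim_col W = p" "dim_row V = q" "dim_col V = q"
    "dim_row D = p" "dim_col D = q" "dim_row D' = q" "dim_col D' = p"
    using W V by (auto simp: unitary_mat_def D_def D'_def)
  have D: "D * (D' * D) = D" "D' * (D * D') = D'"
    unfolding D_def D'_def real_diag_mult
    by (auto intro!: real_diag_cong) (metis left_inverse right_inverse)+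
  have aD: "mat_adjoint (D * D') = D * D'" "mat_adjoint (D' * D) = D' * D"
    unfolding D_def D'_def real_diag_mult by simp_all
  note c = mat_assoc_cancel[OF unitary_matD(3)[OF W]] mat_assoc_cancel[OF unitary_matD(3)[OF V]]
  have "mat_adjoint (W * (D * D') * mat_adjoint W) = W * mat_adjoint (D * D') * mat_adjoint W"
    "mat_adjoint (V * (D' * D) * mat_adjoint V) = V * mat_adjoint (D' * D) * mat_adjoint V"
    by (simp_all add: adjoint_mult mat_assoc_dim d)
  moreover have "W * D * mat_adjoint V * (V * D' * mat_adjoint W) = W * (D * D') * mat_adjoint W"
    "V * D' * mat_adjoint W * (W * D * mat_adjoint V) = V * (D' * D) * mat_adjoint V"
    by (simp_all add: mat_assoc_dim d c)
  moreover have "W * D * mat_adjoint V * (V * D' * mat_adjoint W) * (W * D * mat_adjoint V)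
      = W * (D * (D' * D)) * mat_adjoint V"
    "V * D' * mat_adjoint W * (W * D * mat_adjoint V) * (V * D' * mat_adjoint W)
      = V * (D' * (D * D')) * mat_adjoint W"
    by (simp_all add: mat_assoc_dim d c)
  moreover have "V * D' * mat_adjoint W \<in> carrier_mat q p"
    by (rule carrier_matI) (simp_all add: d)
  ultimately show ?thesis
    unfolding moore_penrose_def D_def[symmetric] D'_def[symmetric] by (simp add: D aD d)
qed

lemma moore_penrose_pinv:
  fixes B :: "'a::real_or_complex mat"
  shows "moore_penrose B (pinv B)"
proof -
  obtain W s V where W: "unitary_mat (dim_row B) W" "unitary_mat (dim_col B) V"
    and B: "B = W * rect_diag (dim_row B) (dim_col B) s * mat_adjoint V"
    using svd_exists[of B] unfolding is_svd_def by blast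
  have "moore_penrose B (V * real_diag (dim_col B) (dim_row B) (\<lambda>i. inverse (s ! i)) * mat_adjoint W)"
    using moore_penrose_unitary_diag[OF W, of "\<lambda>i. s ! i"] B
    unfolding rect_diag_eq_real_diag by (simp only:)
  then show ?thesis using pinv_eqI by metis
qed

text \<open>A left inverse of \<open>B\<close> can be cancelled from \<open>B * pinv B * B = B\<close>.\<close>

lemma pinv_left_inverse:
  fixes B :: "'a::real_or_complex mat"
  assumes B: "B \<in> carrier_mat a k" and F: "F \<in> carrier_mat k a" "F * B = 1\<^sub>m k"
  shows "pinv B * B = 1\<^sub>m k"
proof -
  note mp = moore_penrose_pinv[of B, unfolded moore_penrose_def]
  have d: "dim_row B = a" "dim_col B = k" "dim_row F = k" "dim_col F = a"
    "dim_row (pinv B) = k" "dim_col (pinv B) = a"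
    using B F mp by auto
  have "F * (B * pinv B * B) = F * B" using mp by simp
  then show ?thesis
    by (simp add: mat_assoc_dim d mat_assoc_cancel[OF F(2)] F(2))
qed

text \<open>In the SVD that defines the truncation \<open>T\<close>, the diagonals of \<open>B - T\<close> and \<open>pinv T\<close> have disjoint
  supports.\<close>

lemma sv_truncate_residual:
  fixes B :: "'a::real_or_complex mat" and \<tau> :: real
  defines "T \<equiv> sv_truncate \<tau> B"
  shows "dim_row T = dim_row B" "dim_col T = dim_col B"
    "(B - T) * pinv T = 0\<^sub>m (dim_row B) (dim_row B)"
    "pinv T * (B - T) = 0\<^sub>m (dim_col B) (dim_col B)"
proof -
  define p q where "p = dim_row B" and "q = dim_col B"
  have "\<exists>W s V. is_svd B W s V \<and>
        T = W * rect_diag p q (map (\<lambda>x. if x \<ge> \<tau> then x else 0) s) * mat_adjoint V"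
    unfolding T_def sv_truncate_def p_def q_def by (rule someI_ex) (use svd_exists in blast)
  then obtain W s V where svd: "is_svd B W s V"
    and T0: "T = W * rect_diag p q (map (\<lambda>x. if x \<ge> \<tau> then x else 0) s) * mat_adjoint V" by blast
  define g where "g i = (if s ! i \<ge> \<tau> then s ! i else 0)" for i
  have W: "unitary_mat p W" and V: "unitary_mat q V" and s: "length s = min p q"
    and B: "B = W * real_diag p q (\<lambda>i. s ! i) * mat_adjoint V"
    using svd unfolding is_svd_def rect_diag_eq_real_diag p_def q_def by auto
  have "rect_diag p q (map (\<lambda>x. if x \<ge> \<tau> then x else 0) s) = (real_diag p q g :: 'a mat)"
    unfolding rect_diag_eq_real_diag by (rule real_diag_cong) (simp add: s g_def)
  then have T: "T = W * real_diag p q g * mat_adjoint V" by (simp only: T0)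
  have d: "dim_row W = p" "dim_col W = p" "dim_row V = q" "dim_col V = q"
    using W V by (auto simp: unitary_mat_def)
  have dT: "dim_row T = p" "dim_col T = q" by (simp_all add: T d)
  then show "dim_row T = dim_row B" "dim_col T = dim_col B" by (simp_all add: p_def q_def)
  have X: "pinv T = V * real_diag q p (\<lambda>i. inverse (g i)) * mat_adjoint W"
    unfolding T by (rule pinv_eqI[OF moore_penrose_unitary_diag[OF W V]])
  have BT: "B - T = W * real_diag p q (\<lambda>i. s ! i - g i) * mat_adjoint V"
    unfolding B T real_diag_minus[symmetric] by (simp add: minus_mult_dim mult_minus_dim d)
  note c = mat_assoc_cancel[OF unitary_matD(3)[OF W]] mat_assoc_cancel[OF unitary_matD(3)[OF V]]
  have "(B - T) * pinv T = W * (real_diag p q (\<lambda>i. s ! i - g i) * real_diag q p (\<lambda>i. inverse (g i))) * mat_adjoint W"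
    unfolding BT X by (simp add: mat_assoc_dim d c)
  also have "real_diag p q (\<lambda>i. s ! i - g i) * real_diag q p (\<lambda>i. inverse (g i)) = (0\<^sub>m p p :: 'a mat)"
    unfolding real_diag_mult zero_mat_real_diag by (rule real_diag_cong) (simp add: g_def)
  finally show "(B - T) * pinv T = 0\<^sub>m (dim_row B) (dim_row B)" by (simp add: d flip: p_def)
  have "pinv T * (B - T) = V * (real_diag q p (\<lambda>i. inverse (g i)) * real_diag p q (\<lambda>i. s ! i - g i)) * mat_adjoint V"
    unfolding BT X by (simp add: mat_assoc_dim d c)
  also have "real_diag q p (\<lambda>i. inverse (g i)) * real_diag p q (\<lambda>i. s ! i - g i) = (0\<^sub>m q q :: 'a mat)"
    unfolding real_diag_mult zero_mat_real_diag by (rule real_diag_cong) (simp add: g_def)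
  finally show "pinv T * (B - T) = 0\<^sub>m (dim_col B) (dim_col B)" by (simp add: d flip: q_def)
qed

section \<open>Submatrices\<close>

lemma submatrix_mult:
  fixes F G :: "'a::semiring_0 mat"
  assumes "dim_col F = dim_row G"
  shows "submatrix (F * G) I J = submatrix F I UNIV * submatrix G UNIV J"
proof (rule eq_matI)
  fix i j
  assume "i < dim_row (submatrix F I UNIV * submatrix G UNIV J)" "j < dim_col (submatrix F I UNIV * submatrix G UNIV J)"
  then have ij: "i < card {i. i < dim_row F \<and> i \<in> I}" "j < card {j. j < dim_col G \<and> j \<in> J}"
    by (simp_all add: dim_submatrix)
  then have pk: "pick I i < dim_row F" "pick J j < dim_col G" by (simp_all add: pick_le)
  have "submatrix (F * G) I J $$ (i, j) = (F * G) $$ (pick I i, pick J j)"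
    using ij by (intro submatrix_index) simp_all
  also have "\<dots> = (\<Sum>k<dim_row G. F $$ (pick I i, k) * G $$ (k, pick J j))"
    by (rule index_mult_sum[OF pk assms])
  also have "\<dots> = (\<Sum>k<dim_row G. submatrix F I UNIV $$ (i, k) * submatrix G UNIV J $$ (k, j))"
    using ij assms by (intro sum.cong refl) (simp add: submatrix_index pick_UNIV)
  also have "\<dots> = (submatrix F I UNIV * submatrix G UNIV J) $$ (i, j)"
    using ij assms by (subst index_mult_sum) (simp_all add: dim_submatrix)
  finally show "submatrix (F * G) I J $$ (i, j) = (submatrix F I UNIV * submatrix G UNIV J) $$ (i, j)" .
qed (simp_all add: dim_submatrix)

lemma submatrix_UNIV: "submatrix A UNIV UNIV = A"
  by (rule eq_matI) (simp_all add: dim_submatrix submatrix_index pick_UNIV)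

lemma submatrix_add:
  assumes "dim_row A = dim_row B" "dim_col A = dim_col B"
  shows "submatrix (A + B) I J = submatrix A I J + submatrix B I J"
  using assms by (intro eq_matI) (simp_all add: dim_submatrix submatrix_index pick_le)

lemma submatrix_adjoint: "submatrix (mat_adjoint A) I J = mat_adjoint (submatrix A J I)"
  by (rule eq_matI) (simp_all add: dim_submatrix submatrix_index pick_le)

section \<open>Unitarily invariant norms\<close>

locale unitarily_invariant_norm =
  fixes N :: "'a::real_or_complex mat \<Rightarrow> real"
  assumes family: "norm_family N" and generated: "uniformly_generated N"
    and invariant: "unitarily_invariant N" and submult: "submultiplicative N"
begin

lemma nonneg: "0 \<le> N B"
  using family unfolding norm_family_def by (metis carrier_mat_triv)

lemma smult: "N (c \<cdot>\<^sub>m B) = norm c * N B"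
  using family unfolding norm_family_def by (metis carrier_mat_triv)

lemma triangle:
  assumes "dim_row A = dim_row B" "dim_col A = dim_col B"
  shows "N (A + B) \<le> N A + N B"
  using family assms unfolding norm_family_def by (metis carrier_mat_triv)

lemma triangle_minus:
  assumes "dim_row A = dim_row B" "dim_col A = dim_col B"
  shows "N (A - B) \<le> N A + N B"
proof -
  have "A - B = A + (- 1) \<cdot>\<^sub>m B" using assms by (intro eq_matI) auto
  then show ?thesis using triangle[of A "(- 1) \<cdot>\<^sub>m B"] assms by (simp add: smult)
qed

lemma mult_le:
  assumes "dim_col A = dim_row B"
  shows "N (A * B) \<le> N A * N B"
  using submult assms unfolding submultiplicative_def by (metis carrier_mat_triv)

lemma unitary_mult_left:
  assumes "unitary_mat p W" "dim_row B = p"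
  shows "N (W * B) = N B"
proof -
  have "unitary_mat (dim_col B) (1\<^sub>m (dim_col B) :: 'a mat)" by (intro unitary_matI) simp_all
  moreover have "B \<in> carrier_mat p (dim_col B)" using assms(2) by (intro carrier_matI) simp_all
  ultimately show ?thesis using invariant assms(1) unfolding unitarily_invariant_def by blast
qed

lemma eq_of_common_singular_values:
  assumes "is_compact_svd B W s V" "is_compact_svd B' W' s V'"
  shows "N B = N B'"
proof -
  obtain \<phi> where "\<And>B W s V. is_compact_svd B W s V \<Longrightarrow> N B = \<phi> s"
    using generated unfolding uniformly_generated_def by blast
  from this[OF assms(1)] this[OF assms(2)] show ?thesis by simp
qed

text \<open>If \<open>P * D * V\<^sup>*\<close> is a compact SVD of \<open>B\<close>, then \<open>(W * P) * D * V\<^sup>*\<close> is one of \<open>W * B\<close>, with the same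
  singular values. Invariance under square unitary matrices would not suffice, as \<open>W\<close> may change
  the number of rows.\<close>

lemma isometry_mult_left:
  assumes W: "mat_adjoint W * W = 1\<^sub>m r" "dim_col W = r" and B: "dim_row B = r"
  shows "N (W * B) = N B"
proof -
  obtain P s V where svd: "is_compact_svd B P s V" by (rule compact_svd_exists)
  note c = is_compact_svdD[OF svd]
  define D :: "'a mat" where "D = rect_diag (mat_rank B) (mat_rank B) s"
  have d: "dim_row P = r" "dim_col P = mat_rank B" "dim_row D = mat_rank B" "dim_col D = mat_rank B"
    "dim_row V = dim_col B" "dim_col V = mat_rank B"
    using c(1,3) B by (auto simp: D_def rect_diag_eq_real_diag)
  have "W * B = W * (P * D * mat_adjoint V)" using c(8) by (simp only: D_def)
  also have "\<dots> = W * P * D * mat_adjoint V"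
    by (simp add: mat_assoc_dim d W B)
  finally have WB: "W * B = W * P * D * mat_adjoint V" .
  have "mat_adjoint (W * P) * (W * P) = 1\<^sub>m (mat_rank B)"
    using c(2) by (simp add: mat_assoc_dim adjoint_mult d W(2) mat_assoc_cancel[OF W(1)])
  then have "is_compact_svd (W * B) (W * P) s V"
    using c(3-7) WB unfolding D_def by (intro is_compact_svdI[of _ "dim_row W"]) (auto simp: d)
  from eq_of_common_singular_values[OF this svd] show ?thesis .
qed

text \<open>Taking adjoints exchanges left and right singular vectors and keeps the singular values.\<close>

lemma adjoint_eq: "N (mat_adjoint B) = N B"
proof -
  obtain P s V where svd: "is_compact_svd B P s V" by (rule compact_svd_exists)
  note c = is_compact_svdD[OF svd]
  define D :: "'a mat" where "D = rect_diag (mat_rank B) (mat_rank B) s"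
  have d: "dim_row P = dim_row B" "dim_col P = mat_rank B" "dim_row D = mat_rank B" "dim_col D = mat_rank B"
    "dim_row V = dim_col B" "dim_col V = mat_rank B"
    using c(1,3) by (auto simp: D_def rect_diag_eq_real_diag)
  have "mat_adjoint B = mat_adjoint (P * D * mat_adjoint V)" using c(8) by (simp only: D_def)
  also have "\<dots> = V * mat_adjoint D * mat_adjoint P"
    by (simp add: mat_assoc_dim adjoint_mult d)
  also have "mat_adjoint D = D" by (simp add: D_def rect_diag_eq_real_diag)
  finally have "is_compact_svd (mat_adjoint B) V s P"
    unfolding D_def by (rule is_compact_svdI[OF c(3,4,1,2,5,6,7)])
  from eq_of_common_singular_values[OF this svd] show ?thesis .
qed

text \<open>The reflection \<open>H = 2 * P - 1\<close> is unitary, and \<open>P * B\<close> is the mean of \<open>B\<close> and \<open>H * B\<close>.\<close>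

lemma projection_mult_left:
  assumes P: "P \<in> carrier_mat p p" "mat_adjoint P = P" "P * P = P" and B: "dim_row B = p"
  shows "N (P * B) \<le> N B"
proof -
  define H where "H = P + P - 1\<^sub>m p"
  have d: "dim_row P = p" "dim_col P = p" "dim_row H = p" "dim_col H = p" using P(1) by (auto simp: H_def)
  have aH: "mat_adjoint H = H"
    by (simp add: H_def adjoint_minus adjoint_add d P(2))
  have "H * H = P + P - P - P + 1\<^sub>m p"
    unfolding H_def
    by (rule eq_matI) (auto simp: add_mult_dim mult_add_dim minus_mult_dim mult_minus_dim d P(3) simp del: index_mult_mat(1))
  also have "\<dots> = 1\<^sub>m p" by (rule eq_matI) (auto simp: d)
  finally have "unitary_mat p H" by (intro unitary_matI) (simp_all add: d aH)
  then have HB: "N (H * B) = N B" using B by (rule unitary_mult_left)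
  have "P * B = of_real (1 / 2) \<cdot>\<^sub>m (B + H * B)"
    by (rule eq_matI) (auto simp: H_def minus_mult_dim add_mult_dim d B simp del: index_mult_mat(1))
  then have "N (P * B) = 1 / 2 * N (B + H * B)" by (simp add: smult norm_divide)
  also have "\<dots> \<le> 1 / 2 * (N B + N (H * B))"
    using triangle[of B "H * B"] by (simp add: d B)
  finally show ?thesis by (simp add: HB)
qed

lemma projection_mult_right:
  assumes P: "P \<in> carrier_mat p p" "mat_adjoint P = P" "P * P = P" and B: "dim_col B = p"
  shows "N (B * P) \<le> N B"
proof -
  have "N (B * P) = N (mat_adjoint (B * P))" by (simp only: adjoint_eq)
  also have "\<dots> = N (P * mat_adjoint B)" using P B by (simp add: adjoint_mult)
  also have "\<dots> \<le> N (mat_adjoint B)" by (rule projection_mult_left[OF P]) (simp add: B)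
  finally show ?thesis by (simp only: adjoint_eq)
qed

section \<open>The perturbation bound\<close>

text \<open>The analytic core, free of submatrices: \<open>T\<close> is an approximation of \<open>U + e\<close> whose error is
  annihilated by its pseudoinverse \<open>X\<close> from both sides. Through \<open>U * X = T * X - e * X\<close> and
  \<open>X * U = X * T - X * e\<close>, every product of \<open>U\<close> with \<open>X\<close> becomes a projection up to a term of first
  order in \<open>e\<close>; in particular the norm of \<open>U\<close> itself does not enter the bound.\<close>

lemma factor_perturbation_bound:
  fixes U e EI EJ X T W V L M :: "'a mat"
  assumes dU: "U \<in> carrier_mat a b" and de: "e \<in> carrier_mat a b" and dT: "T \<in> carrier_mat a b"
    and dEI: "EI \<in> carrier_mat a n" and dEJ: "EJ \<in> carrier_mat m b"
    and W: "W \<in> carrier_mat m k" "mat_adjoint W * W = 1\<^sub>m k"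
    and V: "V \<in> carrier_mat n k" "mat_adjoint V * V = 1\<^sub>m k"
    and dL: "L \<in> carrier_mat k a" and dM: "M \<in> carrier_mat k b"
    and X: "moore_penrose T X"
    and res: "(U + e - T) * X = 0\<^sub>m a a" "X * (U + e - T) = 0\<^sub>m b b"
  defines "F \<equiv> W * L" and "G \<equiv> mat_adjoint (V * M)"
  shows "N (F * U * G - (F * U + EJ) * X * (U * G + EI))
    \<le> N L * N EI + N M * N EJ + N L * N M * (2 * N e + N (T - U))
      + N X * ((N L * N EI + N M * N EJ + N L * N M * N e) * N e + N EI * N EJ)"
proof -
  note X' = X[unfolded moore_penrose_def]
  have dX: "dim_row X = b" "dim_col X = a" using X' dT by auto
  have d: "dim_row U = a" "dim_col U = b" "dim_row e = a" "dim_col e = b" "dim_row T = a" "dim_col T = b"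
    "dim_row EI = a" "dim_col EI = n" "dim_row EJ = m" "dim_col EJ = b"
    "dim_row W = m" "dim_col W = k" "dim_row V = n" "dim_col V = k"
    "dim_row L = k" "dim_col L = a" "dim_row M = k" "dim_col M = b"
    using dU de dT dEI dEJ W V dL dM by auto
  have dF: "dim_row F = m" "dim_col F = a" "dim_row G = b" "dim_col G = n"
    by (simp_all add: F_def G_def d)
  note dims = d dX dF
  have NF: "N (F * Z) \<le> N L * N Z" if "dim_row Z = a" for Z
  proof -
    have "N (F * Z) = N (W * (L * Z))" by (simp add: F_def mat_assoc_dim dims that)
    also have "\<dots> = N (L * Z)" by (rule isometry_mult_left[OF W(2)]) (simp_all add: dims)
    also have "\<dots> \<le> N L * N Z" by (rule mult_le) (simp add: dims that)
    finally show ?thesis .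
  qed
  have NG: "N (Z * G) \<le> N Z * N M" if "dim_col Z = b" for Z
  proof -
    have "N (Z * G) = N (mat_adjoint (Z * G))" by (simp only: adjoint_eq)
    also have "\<dots> = N (V * (M * mat_adjoint Z))"
      by (simp add: G_def adjoint_mult mat_assoc_dim dims that)
    also have "\<dots> = N (M * mat_adjoint Z)" by (rule isometry_mult_left[OF V(2)]) (simp_all add: dims)
    also have "\<dots> \<le> N M * N (mat_adjoint Z)" by (rule mult_le) (simp add: dims that)
    finally show ?thesis by (simp only: adjoint_eq mult.commute)
  qed
  define P Q where "P = T * X" and "Q = X * T"
  have P: "P \<in> carrier_mat a a" "mat_adjoint P = P" "P * P = P"
    and Q: "Q \<in> carrier_mat b b" "mat_adjoint Q = Q" "Q * Q = Q"
    using X' by (auto simp: P_def Q_def dims mat_assoc_dim intro!: carrier_matI)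
  have dPQ: "dim_row P = a" "dim_col P = a" "dim_row Q = b" "dim_col Q = b" using P Q by auto
  have UX: "U * X = P - e * X"
  proof (rule eq_matI)
    fix i j assume ij: "i < dim_row (P - e * X)" "j < dim_col (P - e * X)"
    then have "((U + e - T) * X) $$ (i, j) = 0" unfolding res(1) by (simp add: dims)
    then show "(U * X) $$ (i, j) = (P - e * X) $$ (i, j)"
      using ij by (simp add: P_def minus_mult_dim add_mult_dim dims algebra_simps del: index_mult_mat(1))
  qed (simp_all add: dims dPQ)
  have XU: "X * U = Q - X * e"
  proof (rule eq_matI)
    fix i j assume ij: "i < dim_row (Q - X * e)" "j < dim_col (Q - X * e)"
    then have "(X * (U + e - T)) $$ (i, j) = 0" unfolding res(2) by (simp add: dims)
    then show "(X * U) $$ (i, j) = (Q - X * e) $$ (i, j)"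
      using ij by (simp add: Q_def mult_minus_dim mult_add_dim dims algebra_simps del: index_mult_mat(1))
  qed (simp_all add: dims dPQ)
  have NeX: "N (e * X) \<le> N e * N X" and NXe: "N (X * e) \<le> N X * N e"
    by (rule mult_le, simp add: dims)+
  define Y where "Y = U - U * X * U"
  have dY: "dim_row Y = a" "dim_col Y = b" by (simp_all add: Y_def dims)
  \<comment> \<open>The defect of \<open>X\<close> as an inner inverse of \<open>U\<close>: as \<open>T * X * T = T\<close>, it vanishes up to \<open>e\<close> and \<open>T - U\<close>.\<close>
  have "Y = ((P * e + e * Q) - (T - U)) - e * (X * e)"
  proof -
    have "U * X * U = P * U - e * (X * U)" unfolding UX by (simp add: minus_mult_dim mat_assoc_dim dims dPQ)
    also have "P * U = T * (X * U)" by (simp add: P_def mat_assoc_dim dims)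
    also have "\<dots> = T - P * e"
      unfolding XU using X' by (simp add: P_def Q_def mult_minus_dim mat_assoc_dim dims)
    also have "e * (X * U) = e * Q - e * (X * e)"
      unfolding XU by (simp add: mult_minus_dim dims dPQ)
    finally show ?thesis
      unfolding Y_def by (intro eq_matI) (auto simp: dims dPQ algebra_simps simp del: index_mult_mat(1))
  qed
  then have "N Y \<le> N (P * e + e * Q - (T - U)) + N (e * (X * e))"
    by (simp only:) (rule triangle_minus; simp add: dims dPQ)
  also have "N (P * e + e * Q - (T - U)) \<le> N (P * e + e * Q) + N (T - U)"
    by (rule triangle_minus) (simp_all add: dims dPQ)
  also have "N (P * e + e * Q) \<le> N (P * e) + N (e * Q)"
    by (rule triangle) (simp_all add: dims dPQ)
  also have "N (P * e) \<le> N e" by (rule projection_mult_left[OF P]) (simp add: dims)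
  also have "N (e * Q) \<le> N e" by (rule projection_mult_right[OF Q]) (simp add: dims)
  also have "N (e * (X * e)) \<le> N e * N (X * e)" by (rule mult_le) (simp add: dims)
  also have "\<dots> \<le> N e * (N X * N e)" by (rule mult_left_mono[OF NXe nonneg])
  finally have NY: "N Y \<le> 2 * N e + N (T - U) + N e * (N X * N e)" by simp
  have "N (F * Y * G) \<le> N (F * Y) * N M" by (rule NG) (simp add: dY)
  also have "\<dots> \<le> (N L * N Y) * N M" by (rule mult_right_mono[OF NF nonneg]) (simp add: dY)
  also have "\<dots> \<le> (N L * (2 * N e + N (T - U) + N e * (N X * N e))) * N M"
    by (intro mult_right_mono mult_left_mono NY nonneg)
  finally have b1: "N (F * Y * G) \<le> (N L * (2 * N e + N (T - U) + N e * (N X * N e))) * N M" .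
  have "N (U * X * EI) = N (P * EI - e * X * EI)"
    unfolding UX by (simp add: minus_mult_dim dims dPQ)
  also have "\<dots> \<le> N (P * EI) + N (e * X * EI)" by (rule triangle_minus) (simp_all add: dims dPQ)
  also have "N (P * EI) \<le> N EI" by (rule projection_mult_left[OF P]) (simp add: dims)
  also have "N (e * X * EI) \<le> N (e * X) * N EI" by (rule mult_le) (simp add: dims)
  also have "\<dots> \<le> (N e * N X) * N EI" by (rule mult_right_mono[OF NeX nonneg])
  finally have "N (U * X * EI) \<le> N EI + N e * N X * N EI" by simp
  then have "N L * N (U * X * EI) \<le> N L * (N EI + N e * N X * N EI)"
    by (rule mult_left_mono[OF _ nonneg])
  with NF[of "U * X * EI"] have b2: "N (F * (U * X * EI)) \<le> N L * (N EI + N e * N X * N EI)"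
    by (simp add: dims)
  have "N (EJ * (X * U)) = N (EJ * Q - EJ * (X * e))"
    unfolding XU by (simp add: mult_minus_dim dims dPQ)
  also have "\<dots> \<le> N (EJ * Q) + N (EJ * (X * e))" by (rule triangle_minus) (simp_all add: dims dPQ)
  also have "N (EJ * Q) \<le> N EJ" by (rule projection_mult_right[OF Q]) (simp add: dims)
  also have "N (EJ * (X * e)) \<le> N EJ * N (X * e)" by (rule mult_le) (simp add: dims)
  also have "\<dots> \<le> N EJ * (N X * N e)" by (rule mult_left_mono[OF NXe nonneg])
  finally have "N (EJ * (X * U)) \<le> N EJ + N EJ * (N X * N e)" by simp
  then have "N (EJ * (X * U)) * N M \<le> (N EJ + N EJ * (N X * N e)) * N M"
    by (rule mult_right_mono[OF _ nonneg])
  with NG[of "EJ * (X * U)"] have b3: "N (EJ * (X * U) * G) \<le> (N EJ + N EJ * (N X * N e)) * N M"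
    by (simp add: dims)
  have "N (EJ * (X * EI)) \<le> N EJ * N (X * EI)" by (rule mult_le) (simp add: dims)
  also have "\<dots> \<le> N EJ * (N X * N EI)"
    by (rule mult_left_mono[OF mult_le nonneg]) (simp add: dims)
  finally have b4: "N (EJ * (X * EI)) \<le> N EJ * (N X * N EI)" .
  have "F * U * G - (F * U + EJ) * X * (U * G + EI)
      = ((F * Y * G - F * (U * X * EI)) - EJ * (X * U) * G) - EJ * (X * EI)"
    unfolding Y_def
    by (intro eq_matI) (auto simp: add_mult_dim mult_add_dim minus_mult_dim mult_minus_dim mat_assoc_dim dims
        simp del: index_mult_mat(1))
  then have "N (F * U * G - (F * U + EJ) * X * (U * G + EI))
      \<le> N (F * Y * G - F * (U * X * EI) - EJ * (X * U) * G) + N (EJ * (X * EI))"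
    by (simp only:) (rule triangle_minus; simp add: dims)
  also have "N (F * Y * G - F * (U * X * EI) - EJ * (X * U) * G)
      \<le> N (F * Y * G - F * (U * X * EI)) + N (EJ * (X * U) * G)"
    by (rule triangle_minus) (simp_all add: dims)
  also have "N (F * Y * G - F * (U * X * EI)) \<le> N (F * Y * G) + N (F * (U * X * EI))"
    by (rule triangle_minus) (simp_all add: dims)
  finally show ?thesis using b1 b2 b3 b4 by (simp add: algebra_simps)
qed

end

theorem theorem4p2:
  fixes A E At C R U Ct Rt Ut EI EJ EIJ Wk Vk WkI VkJ :: "'a::real_or_complex mat"
    and s :: "real list"
    and N :: "'a mat \<Rightarrow> real"
    and m n k :: nat
    and I J :: "nat set"
    and \<tau> :: real
  assumes A: "A \<in> carrier_mat m n"
    and E: "E \<in> carrier_mat m n"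
    and At: "At = A + E"
    and k: "k = mat_rank A"
    and I: "I \<subseteq> {0..<m}"
    and J: "J \<subseteq> {0..<n}"
    and C: "C = submatrix A UNIV J"
    and R: "R = submatrix A I UNIV"
    and U: "U = submatrix A I J"
    and Ct: "Ct = submatrix At UNIV J"
    and Rt: "Rt = submatrix At I UNIV"
    and Ut: "Ut = submatrix At I J"
    and EI: "EI = submatrix E I UNIV"
    and EJ: "EJ = submatrix E UNIV J"
    and EIJ: "EIJ = submatrix E I J"
    and ranks: "mat_rank C = k" "mat_rank U = k" "mat_rank R = k"
    and svd: "is_compact_svd A Wk s Vk"
    and WkI: "WkI = submatrix Wk I UNIV"
    and VkJ: "VkJ = submatrix Vk J UNIV"
    and N: "norm_family N" "normalized N" "uniformly_generated N"
      "unitarily_invariant N" "submultiplicative N"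
    and tau: "\<tau> \<ge> 0"
  shows "N (A - Ct * pinv (sv_truncate \<tau> Ut) * Rt)
    \<le> N (pinv WkI) * N EI + N (pinv VkJ) * N EJ
      + N (pinv WkI) * N (pinv VkJ) * (2 * N EIJ + N (sv_truncate \<tau> Ut - U))
      + N (pinv (sv_truncate \<tau> Ut))
        * ((N (pinv WkI) * N EI + N (pinv VkJ) * N EJ + N (pinv WkI) * N (pinv VkJ) * N EIJ) * N EIJ
           + N EI * N EJ)"
proof -
  interpret unitarily_invariant_norm N
    using N by unfold_locales
  note c = is_compact_svdD[OF svd, folded k]
  define D :: "'a mat" where "D = rect_diag k k s"
  have dA: "dim_row A = m" "dim_col A = n" "dim_row E = m" "dim_col E = n" using A E by auto
  define a b where "a = card {i. i < m \<and> i \<in> I}" and "b = card {j. j < n \<and> j \<in> J}"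
  have d: "dim_row Wk = m" "dim_col Wk = k" "dim_row Vk = n" "dim_col Vk = k"
    "dim_row D = k" "dim_col D = k"
    using c(1,3) dA by (auto simp: D_def rect_diag_eq_real_diag)
  have dI: "dim_row WkI = a" "dim_col WkI = k" "dim_row VkJ = b" "dim_col VkJ = k"
    "dim_row U = a" "dim_col U = b" "dim_row EIJ = a" "dim_col EIJ = b"
    "dim_row EI = a" "dim_col EI = n" "dim_row EJ = m" "dim_col EJ = b"
    by (simp_all add: WkI VkJ U EIJ EI EJ dim_submatrix d dA a_def b_def)
  have AD: "A = Wk * (D * mat_adjoint Vk)"
    using c(8) by (simp add: D_def[symmetric] mat_assoc_dim d)
  have VJ: "submatrix (D * mat_adjoint Vk) UNIV J = D * mat_adjoint VkJ"
    by (subst submatrix_mult) (simp_all add: d submatrix_UNIV submatrix_adjoint VkJ)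
  have UD: "U = WkI * (D * mat_adjoint VkJ)"
    unfolding U AD by (subst submatrix_mult) (simp_all add: d VJ WkI)
  have CD: "C = Wk * (D * mat_adjoint VkJ)"
    unfolding C AD by (subst submatrix_mult) (simp_all add: d VJ submatrix_UNIV)
  have RD: "R = WkI * (D * mat_adjoint Vk)"
    unfolding R AD by (subst submatrix_mult) (simp_all add: d WkI submatrix_UNIV)
  \<comment> \<open>Since \<open>U\<close> has rank \<open>k\<close>, both \<open>WkI\<close> and \<open>VkJ\<close> have left inverses.\<close>
  have "\<exists>F' H'. F' \<in> carrier_mat k a \<and> F' * WkI = 1\<^sub>m k \<and> H' \<in> carrier_mat b k
      \<and> D * mat_adjoint VkJ * H' = 1\<^sub>m k"
    by (rule full_rank_product_factors_invertible) (use ranks(2) in \<open>auto simp: UD d dI intro!: carrier_matI\<close>)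
  then obtain F' where F': "F' \<in> carrier_mat k a" "F' * WkI = 1\<^sub>m k" by blast
  have WI: "pinv WkI * WkI = 1\<^sub>m k"
    by (rule pinv_left_inverse[OF _ F']) (use dI in auto)
  have "\<exists>F' H'. F' \<in> carrier_mat k a \<and> F' * (WkI * D) = 1\<^sub>m k \<and> H' \<in> carrier_mat b k
      \<and> mat_adjoint VkJ * H' = 1\<^sub>m k"
  proof (rule full_rank_product_factors_invertible)
    show "mat_rank (WkI * D * mat_adjoint VkJ) = k"
      using ranks(2) by (simp add: UD mat_assoc_dim d dI)
  qed (auto simp: d dI intro!: carrier_matI)
  then obtain H' where H': "H' \<in> carrier_mat b k" "mat_adjoint VkJ * H' = 1\<^sub>m k" by blast
  have "mat_adjoint H' * VkJ = mat_adjoint (mat_adjoint VkJ * H')"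
    using H'(1) by (simp add: adjoint_mult dI)
  then have "mat_adjoint H' * VkJ = 1\<^sub>m k" by (simp add: H'(2))
  then have VI: "pinv VkJ * VkJ = 1\<^sub>m k"
    by (rule pinv_left_inverse[rotated 2]) (use dI H' in auto)
  define L M where "L = pinv WkI" and "M = pinv VkJ"
  have dL: "dim_row L = k" "dim_col L = a" "dim_row M = k" "dim_col M = b"
    using moore_penrose_pinv[of WkI] moore_penrose_pinv[of VkJ]
    by (auto simp: moore_penrose_def dI L_def M_def)
  have FU: "Wk * L * U = C"
    unfolding UD CD using WI[folded L_def]
    by (simp add: mat_assoc_dim d dI dL mat_assoc_cancel[OF WI[folded L_def]])
  have "mat_adjoint VkJ * mat_adjoint M = mat_adjoint (M * VkJ)"
    by (simp add: adjoint_mult dI dL)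
  then have VM: "mat_adjoint VkJ * mat_adjoint M = 1\<^sub>m k" using VI by (simp add: M_def)
  have UG: "U * mat_adjoint (Vk * M) = R"
    unfolding UD RD by (simp add: adjoint_mult mat_assoc_dim d dI dL mat_assoc_cancel[OF VM])
  have FUG: "Wk * L * U * mat_adjoint (Vk * M) = A"
    unfolding FU unfolding CD AD
    by (simp add: adjoint_mult mat_assoc_dim d dI dL mat_assoc_cancel[OF VM])
  have pert: "Ct = C + EJ" "Rt = R + EI" "Ut = U + EIJ"
    by (simp_all add: Ct Rt Ut At C R U EI EJ EIJ submatrix_add dA)
  define T where "T = sv_truncate \<tau> Ut"
  note trunc = sv_truncate_residual[where B = Ut and \<tau> = \<tau>, folded T_def]
  have dT: "dim_row T = a" "dim_col T = b" "dim_row Ut = a" "dim_col Ut = b"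
    using trunc(1,2) by (simp_all add: pert dI)
  have "N (Wk * L * U * mat_adjoint (Vk * M)
      - (Wk * L * U + EJ) * pinv T * (U * mat_adjoint (Vk * M) + EI))
    \<le> N L * N EI + N M * N EJ + N L * N M * (2 * N EIJ + N (T - U))
      + N (pinv T) * ((N L * N EI + N M * N EJ + N L * N M * N EIJ) * N EIJ + N EI * N EJ)"
  proof (rule factor_perturbation_bound)
    show "Wk \<in> carrier_mat m k" "mat_adjoint Wk * Wk = 1\<^sub>m k"
      "Vk \<in> carrier_mat n k" "mat_adjoint Vk * Vk = 1\<^sub>m k"
      using c(1-4) dA by simp_all
    show "moore_penrose T (pinv T)" by (rule moore_penrose_pinv)
    show "(U + EIJ - T) * pinv T = 0\<^sub>m a a" "pinv T * (U + EIJ - T) = 0\<^sub>m b b"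
      using trunc(3,4) by (simp_all only: pert(3)[symmetric] dT)
  qed (rule carrier_matI; simp only: dI dL dT)+
  then show ?thesis
    unfolding FUG unfolding FU UG unfolding pert(1,2)[symmetric] L_def M_def T_def .
qed

end
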